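(* Let $\mathcal{H}$ be a complex Hilbert space, let $A\in\mathcal{B}(\mathcal{H})$, let $r\geq 1$ be a real number, and let $0\leq\theta\leq 1$. Suppose that the operator $T_{\theta,r}=|A|^{2r\theta}|A^*|^{2r(1-\theta)}$ is normal. Then \[ w^{2r}(A)\leq \frac14\left\| |A|^{4r\theta}+|A^*|^{4r(1-\theta)}\right\| +\frac12\, r\!\left(|A|^{2r\theta}|A^*|^{2r(1-\theta)}\right), \] where $r(\cdot)$ applied to an operator denotes the spectral radius.
   Context: $\mathcal{B}(\mathcal{H})$ is the algebra of bounded linear operators on the complex Hilbert space $\mathcal{H}$, and $\|\cdot\|$ is the operator norm. For $T\in\mathcal{B}(\mathcal{H})$, the numerical radius is $w(T)=\sup\{|\langle Tx,x\rangle| : x\in\mathcal{H},\ \|x\|=1\}$, and $w^{2r}(T)$ means $(w(T))^{2r}$. $|T|=(T^*T)^{1/2}$, so $|T^*|=(TT^* )^{1/2}$. Real nonnegative powers of positive operators are taken via the continuous functional calculus, with $P^0=I$. The symbol $r$ alone is the real exponent, while $r(T)$ for an operator $T$ is the spectral radius of $T$. *)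

theory Defs
  imports "HOL-Analysis.Analysis"
begin

section \<open>Complex Hilbert spaces\<close>

text \<open>The inner product is linear in its first argument. Definiteness and the triangle inequality
  are inherited from the norm of the superclass \<^class>\<open>banach\<close>, which the last axiom
  ties to the inner product. The zero space is not excluded.\<close>

class chilbert_space = banach +
  fixes scaleC :: "complex \<Rightarrow> 'a \<Rightarrow> 'a" (infixr \<open>*\<^sub>C\<close> 75)
    and cinner :: "'a \<Rightarrow> 'a \<Rightarrow> complex"
  assumes scaleC_add_right: "a *\<^sub>C (x + y) = a *\<^sub>C x + a *\<^sub>C y"
    and scaleC_add_left: "(a + b) *\<^sub>C x = a *\<^sub>C x + b *\<^sub>C x"
    and scaleC_scaleC: "a *\<^sub>C b *\<^sub>C x = (a * b) *\<^sub>C x"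
    and scaleR_scaleC: "t *\<^sub>R x = complex_of_real t *\<^sub>C x"
    and cinner_commute: "cinner x y = cnj (cinner y x)"
    and cinner_add_left: "cinner (x + y) z = cinner x z + cinner y z"
    and cinner_scaleC_left: "cinner (a *\<^sub>C x) y = a * cinner x y"
    and cinner_self: "cinner x x = complex_of_real ((norm x)\<^sup>2)"

section \<open>Bounded operators\<close>

text \<open>Operators are functions satisfying the following predicate; their norm is
  \<^const>\<open>onorm\<close> and their product is composition.\<close>

definition bounded_clinear :: "('a::chilbert_space \<Rightarrow> 'a) \<Rightarrow> bool" where
  "bounded_clinear T \<longleftrightarrow> bounded_linear T \<and> (\<forall>a x. T (a *\<^sub>C x) = a *\<^sub>C T x)"

definition cadjoint :: "('a::chilbert_space \<Rightarrow> 'a) \<Rightarrow> 'a \<Rightarrow> 'a" where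
  "cadjoint T = (THE S. bounded_clinear S \<and> (\<forall>x y. cinner (T x) y = cinner x (S y)))"

definition normal_operator :: "('a::chilbert_space \<Rightarrow> 'a) \<Rightarrow> bool" where
  "normal_operator T \<longleftrightarrow> cadjoint T \<circ> T = T \<circ> cadjoint T"

definition invertible_operator :: "('a::chilbert_space \<Rightarrow> 'a) \<Rightarrow> bool" where
  "invertible_operator T \<longleftrightarrow> (\<exists>S. bounded_clinear S \<and> S \<circ> T = id \<and> T \<circ> S = id)"

definition spectrum :: "('a::chilbert_space \<Rightarrow> 'a) \<Rightarrow> complex set" where
  "spectrum T = {c. \<not> invertible_operator (\<lambda>x. c *\<^sub>C x - T x)}"

text \<open>In the next two suprema the element 0 matters only for the zero space, which has no unit
  vectors and whose operators have empty spectrum: there both quantities are 0.\<close>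

definition spectral_radius :: "('a::chilbert_space \<Rightarrow> 'a) \<Rightarrow> real" where
  "spectral_radius T = Sup (insert 0 {cmod c |c. c \<in> spectrum T})"

definition numerical_radius :: "('a::chilbert_space \<Rightarrow> 'a) \<Rightarrow> real" where
  "numerical_radius T = Sup (insert 0 {cmod (cinner (T x) x) |x. norm x = 1})"

section \<open>Continuous functional calculus and powers of positive operators\<close>

definition poly_operator :: "real poly \<Rightarrow> ('a::chilbert_space \<Rightarrow> 'a) \<Rightarrow> 'a \<Rightarrow> 'a" where
  "poly_operator p T = (\<lambda>x. \<Sum>i\<le>degree p. coeff p i *\<^sub>R (T ^^ i) x)"

text \<open>For self-adjoint \<open>T\<close> and real \<open>f\<close> continuous on the (real) spectrum of \<open>T\<close>, this is \<open>f(T)\<close>: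
  the common operator-norm limit of \<open>p\<^sub>n(T)\<close> over all sequences of real polynomials \<open>p\<^sub>n\<close>
  converging to \<open>f\<close> uniformly on the spectrum. For other arguments the value is meaningless.\<close>

definition cont_fun_calc ::
    "(real \<Rightarrow> real) \<Rightarrow> ('a::chilbert_space \<Rightarrow> 'a) \<Rightarrow> 'a \<Rightarrow> 'a" where
  "cont_fun_calc f T = (THE S. bounded_clinear S \<and>
     (\<forall>p. uniform_limit {t. complex_of_real t \<in> spectrum T} (\<lambda>n t. poly (p n) t) f sequentially
       \<longrightarrow> (\<lambda>n. onorm (\<lambda>x. poly_operator (p n) T x - S x)) \<longlonglongrightarrow> 0))"

text \<open>The case distinction is needed for \<open>P\<^sup>0 = I\<close>, since \<^term>\<open>(0::real) powr 0 = 0\<close>.\<close>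

definition op_powr :: "('a::chilbert_space \<Rightarrow> 'a) \<Rightarrow> real \<Rightarrow> 'a \<Rightarrow> 'a" (infixr \<open>powr\<^sub>o\<^sub>p\<close> 80) where
  "P powr\<^sub>o\<^sub>p s = cont_fun_calc (\<lambda>t. if s = 0 then 1 else t powr s) P"

definition op_abs :: "('a::chilbert_space \<Rightarrow> 'a) \<Rightarrow> 'a \<Rightarrow> 'a" where
  "op_abs T = (cadjoint T \<circ> T) powr\<^sub>o\<^sub>p (1/2)"

end

theory Submission
  imports Defs "HOL-Computational_Algebra.Fundamental_Theorem_Algebra"
begin

text \<open>
  Write \<open>P = \<bar>A\<bar>\<close>, \<open>Q = \<bar>A\<^sup>*\<bar>\<close>, \<open>X = P\<^bsup>2r\<theta>\<^esup>\<close>, \<open>Y = Q\<^bsup>2r(1-\<theta>)\<^esup>\<close>, and let \<open>x\<close> be a unit vector.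
  The mixed Schwarz inequality (\<open>mixed_Schwarz_inequality\<close>) gives
  \<open>\<bar>\<langle>A x, x\<rangle>\<bar>\<^sup>2 \<le> \<langle>P\<^bsup>2\<theta>\<^esup> x, x\<rangle> \<langle>Q\<^bsup>2(1-\<theta>)\<^esup> x, x\<rangle>\<close>, and the Hoelder-McCarthy inequality
  (\<open>Holder_McCarthy_inequality\<close>) moves the \<open>r\<close>-th power inside both factors, so that
  \<open>\<bar>\<langle>A x, x\<rangle>\<bar>\<^bsup>2r\<^esup> \<le> \<langle>X x, x\<rangle> \<langle>x, Y x\<rangle>\<close>.  Buzano's inequality (\<open>Buzano_inequality\<close>) bounds this product
  by half of \<open>\<parallel>X x\<parallel> \<parallel>Y x\<parallel> + \<bar>\<langle>X x, Y x\<rangle>\<bar>\<close>.  The first summand is at most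
  \<open>\<langle>(X\<^sup>2 + Y\<^sup>2) x, x\<rangle> / 2 \<le> \<parallel>X\<^sup>2 + Y\<^sup>2\<parallel> / 2\<close>; the second is \<open>\<bar>\<langle>x, X Y x\<rangle>\<bar> \<le> \<parallel>X Y x\<parallel>\<close>, which for normal
  \<open>X Y\<close> is at most the spectral radius of \<open>X Y\<close> (\<open>norm_normal_product_le_spectral_radius\<close>).

  These steps rest on the continuous functional calculus.  It exists because \<open>\<parallel>p(T)\<parallel> \<le> sup \<bar>p\<bar>\<close>, the
  supremum taken over the spectrum of the self-adjoint operator \<open>T\<close> (\<open>onorm_poly_operator_le\<close>): a bounded
  self-adjoint \<open>S\<close> on a nonzero space has a non-invertible \<open>\<parallel>S\<parallel>\<^sup>2 - S\<^sup>2\<close>, and for \<open>S = p(T)\<close> the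
  fundamental theorem of algebra turns this into a spectral value \<open>t\<close> of \<open>T\<close> with
  \<open>\<bar>p(t)\<bar> = \<parallel>p(T)\<parallel>\<close>.  Weierstrass approximation on \<open>[0, \<parallel>P\<parallel>]\<close> then defines \<open>f(P)\<close> for positive \<open>P\<close>
  and makes \<open>f \<mapsto> f(P)\<close> additive, multiplicative and monotone, and such that an operator that intertwines
  \<open>P\<^sup>2\<close> and \<open>Q\<^sup>2\<close> also intertwines \<open>f(P)\<close> and \<open>f(Q)\<close> (\<open>cont_fun_calc_intertwine\<close>).
\<close>

section \<open>Inner product inequalities\<close>

lemma scaleC_one [simp]: "1 *\<^sub>C (x::'a::chilbert_space) = x"
  using scaleR_scaleC[of 1 x] by simp

lemma scaleC_minus_one: "(- 1) *\<^sub>C (x::'a::chilbert_space) = - x"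
  using scaleR_scaleC[of "-1" x] by simp

lemma scaleC_zero_left [simp]: "0 *\<^sub>C (x::'a::chilbert_space) = 0"
  using scaleR_scaleC[of 0 x] by simp

lemma scaleC_zero_right [simp]: "c *\<^sub>C (0::'a::chilbert_space) = 0"
  using scaleC_add_right[of c 0 "0::'a"] by simp

lemma scaleC_minus_right: "c *\<^sub>C (- (x::'a::chilbert_space)) = - (c *\<^sub>C x)"
  using scaleC_add_right[of c x "-x"] by (simp add: eq_neg_iff_add_eq_0 add.commute)

lemma scaleC_minus_left: "(- c) *\<^sub>C (x::'a::chilbert_space) = - (c *\<^sub>C x)"
  using scaleC_add_left[of c "-c" x] by (simp add: eq_neg_iff_add_eq_0 add.commute)

lemma scaleC_diff_right: "c *\<^sub>C ((x::'a::chilbert_space) - y) = c *\<^sub>C x - c *\<^sub>C y"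
  using scaleC_add_right[of c x "-y"] by (simp add: scaleC_minus_right)

lemma scaleC_sum_right: "c *\<^sub>C (\<Sum>i\<in>I. f i) = (\<Sum>i\<in>I. c *\<^sub>C (f i :: 'a::chilbert_space))"
  by (induction I rule: infinite_finite_induct) (auto simp: scaleC_add_right)

lemma cinner_add_right: "cinner x (y + z) = cinner x y + cinner x (z::'a::chilbert_space)"
  by (metis cinner_add_left cinner_commute complex_cnj_add)

lemma cinner_scaleC_right: "cinner x (c *\<^sub>C y) = cnj c * cinner x (y::'a::chilbert_space)"
  by (metis cinner_scaleC_left cinner_commute complex_cnj_mult)

lemma cinner_scaleR_left: "cinner (t *\<^sub>R x) y = complex_of_real t * cinner x (y::'a::chilbert_space)"
  by (simp add: scaleR_scaleC cinner_scaleC_left)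

lemma cinner_scaleR_right: "cinner x (t *\<^sub>R y) = complex_of_real t * cinner x (y::'a::chilbert_space)"
  by (simp add: scaleR_scaleC cinner_scaleC_right)

lemma cinner_zero [simp]: "cinner 0 (x::'a::chilbert_space) = 0" "cinner (x::'a::chilbert_space) 0 = 0"
  using cinner_scaleR_left[of 0 0 x] cinner_scaleR_right[of x 0 0] by simp_all

lemma cinner_minus_left: "cinner (- x) (y::'a::chilbert_space) = - cinner x y"
  using cinner_scaleR_left[of "-1" x y] by simp

lemma cinner_minus_right: "cinner x (- (y::'a::chilbert_space)) = - cinner x y"
  using cinner_scaleR_right[of x "-1" y] by simp

lemma cinner_diff_left: "cinner (x - y) (z::'a::chilbert_space) = cinner x z - cinner y z"
  using cinner_add_left[of x "-y" z] by (simp add: cinner_minus_left)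

lemma cinner_diff_right: "cinner x ((y::'a::chilbert_space) - z) = cinner x y - cinner x z"
  using cinner_add_right[of x y "-z"] by (simp add: cinner_minus_right)

lemmas cinner_simps = cinner_add_left cinner_add_right cinner_diff_left cinner_diff_right
  cinner_scaleC_left cinner_scaleC_right cinner_scaleR_left cinner_scaleR_right
  cinner_minus_left cinner_minus_right

lemma Re_cinner_commute: "Re (cinner x y) = Re (cinner y (x::'a::chilbert_space))"
  by (metis cinner_commute cnj.simps(1))

lemma power2_norm_eq_Re_cinner: "(norm (x::'a::chilbert_space))\<^sup>2 = Re (cinner x x)"
  by (simp add: cinner_self)

lemma power2_norm_add:
  "(norm ((x::'a::chilbert_space) + y))\<^sup>2 = (norm x)\<^sup>2 + (norm y)\<^sup>2 + 2 * Re (cinner x y)"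
  using Re_cinner_commute[of x y] by (simp add: power2_norm_eq_Re_cinner cinner_simps)

lemma power2_norm_diff:
  "(norm ((x::'a::chilbert_space) - y))\<^sup>2 = (norm x)\<^sup>2 + (norm y)\<^sup>2 - 2 * Re (cinner x y)"
  using Re_cinner_commute[of x y] by (simp add: power2_norm_eq_Re_cinner cinner_simps)

lemma norm_scaleC: "norm (c *\<^sub>C (x::'a::chilbert_space)) = cmod c * norm x"
proof -
  have "complex_of_real ((norm (c *\<^sub>C x))\<^sup>2) = (c * cnj c) * cinner x x"
    by (simp only: cinner_self[symmetric] cinner_simps mult_ac)
  also have "\<dots> = complex_of_real ((cmod c * norm x)\<^sup>2)"
    by (simp add: complex_norm_square[symmetric] cinner_self power_mult_distrib)
  finally have "complex_of_real ((norm (c *\<^sub>C x))\<^sup>2) = complex_of_real ((cmod c * norm x)\<^sup>2)" .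
  hence "(norm (c *\<^sub>C x))\<^sup>2 = (cmod c * norm x)\<^sup>2"
    using of_real_eq_iff by blast
  thus ?thesis by (simp add: power2_eq_iff_nonneg)
qed

lemma cinner_left_eqI: "(\<And>x. cinner x y = cinner x z) \<Longrightarrow> y = (z::'a::chilbert_space)"
proof -
  assume *: "\<And>x. cinner x y = cinner x z"
  have "cinner (y - z) (y - z) = 0"
    using *[of "y - z"] by (simp add: cinner_diff_right)
  thus ?thesis by (simp add: cinner_self)
qed

lemma cinner_Cauchy_Schwarz: "cmod (cinner x y) \<le> norm x * norm (y::'a::chilbert_space)"
proof (cases "y = 0")
  case False
  define c n where "c = cinner x y" and "n = (norm y)\<^sup>2"
  have n: "n > 0" using False by (simp add: n_def)
  have "0 \<le> (norm (n *\<^sub>R x - c *\<^sub>C y))\<^sup>2" by simp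
  also have "\<dots> = n\<^sup>2 * (norm x)\<^sup>2 + (cmod c)\<^sup>2 * n - 2 * (n * (cmod c)\<^sup>2)"
  proof -
    have "cinner (n *\<^sub>R x) (c *\<^sub>C y) = complex_of_real n * (c * cnj c)"
      by (simp only: cinner_simps c_def mult_ac)
    hence "Re (cinner (n *\<^sub>R x) (c *\<^sub>C y)) = n * (cmod c)\<^sup>2"
      by (simp only: complex_norm_square[symmetric] of_real_mult[symmetric] Re_complex_of_real)
    thus ?thesis
      by (simp add: power2_norm_diff norm_scaleC power_mult_distrib) (simp add: n_def)
  qed
  also have "\<dots> = n * (n * (norm x)\<^sup>2 - (cmod c)\<^sup>2)" by (simp add: algebra_simps power2_eq_square)
  finally have "(cmod c)\<^sup>2 \<le> n * (norm x)\<^sup>2" using n by (simp add: zero_le_mult_iff)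
  hence "(cmod c)\<^sup>2 \<le> (norm x * norm y)\<^sup>2" by (simp add: n_def power_mult_distrib mult.commute)
  thus ?thesis unfolding c_def by (rule power2_le_imp_le) simp
qed simp

lemma cmod_cinner_commute: "cmod (cinner x y) = cmod (cinner y (x::'a::chilbert_space))"
  by (metis cinner_commute complex_mod_cnj)

text \<open>Buzano's inequality.  The reflection \<open>2\<langle>x,e\<rangle>e - x\<close> of \<open>x\<close> in the line of \<open>e\<close> has the norm
  of \<open>x\<close>, so the Cauchy-Schwarz inequality for it and \<open>y\<close> gives the claim.\<close>

lemma Buzano_inequality:
  fixes x y e :: "'a::chilbert_space"
  assumes "norm e = 1"
  shows "2 * cmod (cinner x e * cinner e y) \<le> norm x * norm y + cmod (cinner x y)"
proof -
  define c where "c = cinner x e"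
  define v where "v = (2 * c) *\<^sub>C e - x"
  have "cinner e x = cnj c" by (metis c_def cinner_commute)
  hence "(norm v)\<^sup>2 = 4 * (cmod c)\<^sup>2 + (norm x)\<^sup>2 - 2 * Re (complex_of_real 2 * (c * cnj c))"
    using assms
    by (simp add: v_def power2_norm_diff norm_scaleC power_mult_distrib cinner_simps norm_mult)
  also have "Re (complex_of_real 2 * (c * cnj c)) = 2 * (cmod c)\<^sup>2"
    by (simp only: complex_norm_square[symmetric] of_real_mult[symmetric] Re_complex_of_real)
  finally have "(norm v)\<^sup>2 = (norm x)\<^sup>2" by simp
  hence v: "norm v = norm x" by simp
  have "2 * cmod (c * cinner e y) = cmod (2 * c * cinner e y)" by (simp add: norm_mult)
  also have "2 * c * cinner e y = cinner v y + cinner x y" by (simp add: v_def cinner_simps)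
  also have "cmod \<dots> \<le> norm x * norm y + cmod (cinner x y)"
    using cinner_Cauchy_Schwarz[of v y] norm_triangle_ineq[of "cinner v y" "cinner x y"] v by simp
  finally show ?thesis by (simp add: c_def)
qed

section \<open>Bounded operators, adjoints and invertibility\<close>

lemma bounded_clinearI:
  assumes "\<And>x y. T (x + y) = T x + T y" "\<And>c x. T (c *\<^sub>C x) = c *\<^sub>C T x"
    and "\<And>x. norm (T x) \<le> K * norm (x::'a::chilbert_space)"
  shows "bounded_clinear T"
proof -
  have "bounded_linear T"
    by (rule bounded_linear_intro[where K = K])
      (use assms in \<open>simp_all add: scaleR_scaleC mult.commute[of _ K]\<close>)
  thus ?thesis using assms(2) by (simp add: bounded_clinear_def)
qed

lemma bounded_clinear_imp_bounded_linear: "bounded_clinear T \<Longrightarrow> bounded_linear T"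
  by (simp add: bounded_clinear_def)

lemma bounded_clinear_norm_le: "bounded_clinear T \<Longrightarrow> norm (T x) \<le> onorm T * norm x"
  by (simp add: bounded_clinear_def onorm)

lemma bounded_clinear_onorm_nonneg: "bounded_clinear T \<Longrightarrow> 0 \<le> onorm T"
  by (simp add: bounded_clinear_def onorm_pos_le)

lemma
  assumes "bounded_clinear T"
  shows bounded_clinear_add: "T (x + y) = T x + T y"
    and bounded_clinear_diff: "T (x - y) = T x - T y"
    and bounded_clinear_scaleC: "T (c *\<^sub>C x) = c *\<^sub>C T x"
    and bounded_clinear_scaleR: "T (t *\<^sub>R x) = t *\<^sub>R T x"
    and bounded_clinear_zero: "T 0 = 0"
proof -
  have bl: "bounded_linear T" using assms by (simp add: bounded_clinear_def)
  interpret bounded_linear T by fact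
  show "T (x + y) = T x + T y" "T (x - y) = T x - T y" "T (t *\<^sub>R x) = t *\<^sub>R T x" "T 0 = 0"
    by (simp_all add: add diff scaleR zero)
  show "T (c *\<^sub>C x) = c *\<^sub>C T x" using assms by (simp add: bounded_clinear_def)
qed

lemmas bounded_clinear_simps = bounded_clinear_add bounded_clinear_diff bounded_clinear_scaleC
  bounded_clinear_scaleR bounded_clinear_zero

lemma bounded_clinear_compose:
  assumes "bounded_clinear S" "bounded_clinear T"
  shows "bounded_clinear (\<lambda>x. S (T x))"
  using assms bounded_linear_compose unfolding bounded_clinear_def by auto

lemma bounded_clinear_scaleC_const: "bounded_clinear (\<lambda>x::'a::chilbert_space. c *\<^sub>C x)"
  by (rule bounded_clinearI[where K = "cmod c"])
    (simp_all add: scaleC_add_right scaleC_scaleC norm_scaleC mult.commute)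

lemma bounded_clinear_sum_ops:
  assumes "bounded_clinear S" "bounded_clinear T"
  shows "bounded_clinear (\<lambda>x. S x + T x)" "bounded_clinear (\<lambda>x. S x - T x)"
  using assms bounded_linear_add bounded_linear_sub unfolding bounded_clinear_def
  by (auto simp: scaleC_add_right scaleC_diff_right)

lemma bounded_clinear_id: "bounded_clinear (\<lambda>x. x)"
  by (simp add: bounded_clinear_def bounded_linear_ident)

lemma bounded_clinear_null: "bounded_clinear (\<lambda>x. 0)"
  by (simp add: bounded_clinear_def)

lemmas bounded_clinear_intros = bounded_clinear_scaleC_const
  bounded_clinear_sum_ops bounded_clinear_id bounded_clinear_null

lemma cmod_cinner_operator_le:
  assumes "bounded_clinear T"
  shows "cmod (cinner (T x) y) \<le> onorm T * norm x * norm y"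
  using cinner_Cauchy_Schwarz[of "T x" y] bounded_clinear_norm_le[OF assms, of x]
  by (meson mult_right_mono norm_ge_zero order_trans)

definition bounded_below :: "('a::chilbert_space \<Rightarrow> 'a) \<Rightarrow> bool" where
  "bounded_below T \<longleftrightarrow> (\<exists>\<delta>>0. \<forall>x. \<delta> * norm x \<le> norm (T x))"

text \<open>Riesz representation for the equivalent inner product \<open>\<langle>X x, X z\<rangle>\<close>.  The representing vector
  minimises \<open>J x = \<parallel>X x\<parallel>\<^sup>2 - 2 Re (f x)\<close>: minimising sequences are Cauchy by the parallelogram
  law, and the derivative of \<open>J\<close> vanishes at the minimiser.  The operator \<open>X\<close> makes the lemma serve
  two ends: \<open>X = I\<close> yields adjoints, and \<open>X = T\<^sup>*\<close> yields surjectivity of \<open>T\<close>.\<close>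

lemma Riesz_representation_bounded_below:
  fixes X :: "'a::chilbert_space \<Rightarrow> 'a" and f :: "'a \<Rightarrow> complex"
  assumes X: "bounded_clinear X" and bb: "bounded_below X"
    and f_add: "\<And>x y. f (x + y) = f x + f y" and f_scale: "\<And>c x. f (c *\<^sub>C x) = c * f x"
    and f_bd: "\<And>x. cmod (f x) \<le> K * norm x"
  shows "\<exists>z. \<forall>x. f x = cinner (X x) (X z)"
proof -
  obtain \<delta> where \<delta>: "\<delta> > 0" "\<And>x. \<delta> * norm x \<le> norm (X x)"
    using bb by (auto simp: bounded_below_def)
  note [simp] = bounded_clinear_simps[OF X]
  have f_scaleR: "f (t *\<^sub>R x) = t * f x" for t x by (simp add: scaleR_scaleC f_scale)
  define J where "J = (\<lambda>x. (norm (X x))\<^sup>2 - 2 * Re (f x))"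
  have J_ge: "- (K / \<delta>)\<^sup>2 \<le> J x" for x
  proof -
    have "(\<delta> * norm x)\<^sup>2 \<le> (norm (X x))\<^sup>2" using \<delta> by (intro power_mono) auto
    moreover have "Re (f x) \<le> K * norm x" using f_bd[of x] complex_Re_le_cmod order_trans by blast
    moreover have "0 \<le> (\<delta> * norm x - K / \<delta>)\<^sup>2" by simp
    hence "2 * (K * norm x) \<le> (\<delta> * norm x)\<^sup>2 + (K / \<delta>)\<^sup>2"
      using \<delta>(1) by (simp add: power2_diff mult.commute)
    ultimately show ?thesis unfolding J_def by linarith
  qed
  hence bdd: "bdd_below (range J)" by (meson bdd_belowI2)
  define m where "m = Inf (range J)"
  have m_le: "m \<le> J x" for x unfolding m_def by (rule cInf_lower[OF _ bdd]) simp
  have "\<exists>z. J z < m + inverse (real (Suc n))" for n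
    using cInf_lessD[of "range J" "m + inverse (real (Suc n))"] by (auto simp: m_def)
  then obtain z where z: "\<And>n. J (z n) < m + inverse (real (Suc n))" by metis
  have par: "\<delta>\<^sup>2 * (norm (a - b))\<^sup>2 \<le> 2 * J a + 2 * J b - 4 * m" for a b
  proof -
    have "\<delta>\<^sup>2 * (norm (a - b))\<^sup>2 \<le> (norm (X (a - b)))\<^sup>2"
      using power_mono[OF \<delta>(2)[of "a - b"], of 2] \<delta>(1) by (simp add: power_mult_distrib)
    also have "\<dots> = 2 * J a + 2 * J b - 4 * J ((1/2) *\<^sub>R (a + b))"
    proof -
      have "X ((1/2) *\<^sub>R (a + b)) = (1/2) *\<^sub>R (X a + X b)" by simp
      hence "(norm (X ((1/2) *\<^sub>R (a + b))))\<^sup>2 = (norm (X a + X b))\<^sup>2 / 4"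
        by (simp only: norm_scaleR power_mult_distrib) (simp add: power2_eq_square)
      moreover have "Re (f ((1/2) *\<^sub>R (a + b))) = (Re (f a) + Re (f b)) / 2"
        by (simp only: f_scaleR f_add) simp
      ultimately have
        "4 * J ((1/2) *\<^sub>R (a + b)) = (norm (X a + X b))\<^sup>2 - 4 * (Re (f a) + Re (f b))"
        by (simp add: J_def)
      thus ?thesis
        using power2_norm_diff[of "X a" "X b"] power2_norm_add[of "X a" "X b"]
        by (simp add: J_def)
    qed
    also have "\<dots> \<le> 2 * J a + 2 * J b - 4 * m" using m_le by simp
    finally show ?thesis .
  qed
  have "Cauchy z"
  proof (rule metric_CauchyI)
    fix e :: real assume e: "e > 0"
    define q where "q = \<delta>\<^sup>2 * e\<^sup>2"
    obtain N where N: "inverse (real (Suc N)) < q / 4"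
      using reals_Archimedean[of "q / 4"] \<delta>(1) e by (auto simp: q_def)
    have *: "J (z n) - m < q / 4" if "n \<ge> N" for n
    proof -
      have "inverse (real (Suc n)) \<le> inverse (real (Suc N))" using that by (simp add: field_simps)
      thus ?thesis using z[of n] N by linarith
    qed
    show "\<exists>N. \<forall>m\<ge>N. \<forall>n\<ge>N. dist (z m) (z n) < e"
    proof (intro exI allI impI)
      fix i j assume ij: "i \<ge> N" "j \<ge> N"
      hence "\<delta>\<^sup>2 * (norm (z i - z j))\<^sup>2 < q"
        using par[of "z i" "z j"] *[OF ij(1)] *[OF ij(2)] by linarith
      hence "(norm (z i - z j))\<^sup>2 < e\<^sup>2" using \<delta>(1) by (simp add: q_def)
      thus "dist (z i) (z j) < e" using e by (simp add: dist_norm power_less_imp_less_base)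
    qed
  qed
  then obtain w where w: "z \<longlonglongrightarrow> w" using Cauchy_convergent_iff convergent_def by blast
  have bl: "bounded_linear X" by (rule bounded_clinear_imp_bounded_linear[OF X])
  have blf: "bounded_linear f"
    by (rule bounded_linear_intro[where K = K])
      (use f_add f_scaleR f_bd in \<open>auto simp: scaleR_conv_of_real mult.commute\<close>)
  have lim: "(\<lambda>n. J (z n)) \<longlonglongrightarrow> J w" unfolding J_def
    by (intro tendsto_intros bounded_linear.tendsto[OF bl] bounded_linear.tendsto[OF blf] w)
  have "(\<lambda>n. m + inverse (real (Suc n))) \<longlonglongrightarrow> m + 0"
    by (intro tendsto_intros LIMSEQ_inverse_real_of_nat)
  hence "J w \<le> m + 0"
    by (rule LIMSEQ_le[OF lim]) (use z less_imp_le in blast)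
  hence min: "J w \<le> J x" for x using m_le[of x] by simp
  \<comment> \<open>The quadratic \<open>t \<mapsto> t\<^sup>2 a + 2 t b\<close> below is \<open>J (w + t h) - J w\<close>.  Its value at \<open>-b / (a + 1)\<close> is
    negative unless \<open>b = 0\<close>; the summand 1 covers \<open>a = 0\<close>.\<close>
  have Re_eq: "Re (f h) = Re (cinner (X h) (X w))" for h
  proof -
    define b where "b = Re (cinner (X h) (X w)) - Re (f h)"
    define a where "a = (norm (X h))\<^sup>2"
    have quad: "0 \<le> t\<^sup>2 * a + 2 * t * b" for t
      using min[of "w + t *\<^sub>R h"] Re_cinner_commute[of "X h" "X w"]
      by (simp add: J_def power2_norm_add f_add f_scaleR cinner_simps a_def b_def
          power_mult_distrib algebra_simps)
    have a: "a \<ge> 0" by (simp add: a_def)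
    have "0 \<le> (b / (a+1))\<^sup>2 * a - 2 * (b / (a+1)) * b" using quad[of "- b / (a + 1)"] by simp
    also have "\<dots> = - (b\<^sup>2 * (a + 2) / (a + 1)\<^sup>2)"
      using a by (simp add: field_simps power2_eq_square add_nonneg_eq_0_iff)
    finally have "b\<^sup>2 * (a + 2) \<le> 0"
      using a by (simp add: divide_le_0_iff zero_le_divide_iff)
    hence "b = 0" using a by (simp add: mult_le_0_iff)
    thus ?thesis by (simp add: b_def)
  qed
  have "f h = cinner (X h) (X w)" for h
    using Re_eq[of h] Re_eq[of "\<i> *\<^sub>C h"] by (simp add: f_scale cinner_simps complex_eq_iff)
  thus ?thesis by blast
qed

definition adjoint_pair :: "('a::chilbert_space \<Rightarrow> 'a) \<Rightarrow> ('a \<Rightarrow> 'a) \<Rightarrow> bool" where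
  "adjoint_pair T S \<longleftrightarrow> (\<forall>x y. cinner (T x) y = cinner x (S y))"

lemma adjoint_pairD: "adjoint_pair T S \<Longrightarrow> cinner (T x) y = cinner x (S y)"
  by (simp add: adjoint_pair_def)

lemma adjoint_pair_sym: "adjoint_pair T S \<Longrightarrow> adjoint_pair S T"
  unfolding adjoint_pair_def by (metis cinner_commute)

lemma adjoint_pair_unique: "adjoint_pair T S \<Longrightarrow> adjoint_pair T S' \<Longrightarrow> S = S'"
  unfolding adjoint_pair_def by (intro ext cinner_left_eqI) metis

lemma adjoint_exists:
  fixes T :: "'a::chilbert_space \<Rightarrow> 'a"
  assumes T: "bounded_clinear T"
  shows "\<exists>S. bounded_clinear S \<and> adjoint_pair T S"
proof -
  have "\<exists>z. \<forall>x. cinner (T x) y = cinner x z" for y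
  proof (rule Riesz_representation_bounded_below[OF bounded_clinear_id])
    show "bounded_below (\<lambda>x::'a. x)" unfolding bounded_below_def by (intro exI[of _ 1]) simp
    show "cmod (cinner (T x) y) \<le> (onorm T * norm y) * norm x" for x
      using cmod_cinner_operator_le[OF T, of x y] by (simp add: algebra_simps)
  qed (simp_all add: bounded_clinear_simps[OF T] cinner_simps)
  then obtain S where S: "\<And>x y. cinner (T x) y = cinner x (S y)" by metis
  have "norm (S y) \<le> onorm T * norm y" for y
  proof -
    have "(norm (S y))\<^sup>2 = cmod (cinner (T (S y)) y)" by (simp add: S cinner_self norm_power)
    also have "\<dots> \<le> onorm T * norm (S y) * norm y" by (rule cmod_cinner_operator_le[OF T])
    finally show ?thesis
      using bounded_clinear_onorm_nonneg[OF T]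
      by (cases "norm (S y) = 0") (auto simp: power2_eq_square mult_le_cancel_left_pos algebra_simps)
  qed
  hence "bounded_clinear S"
    by (intro bounded_clinearI cinner_left_eqI) (simp_all add: S[symmetric] cinner_simps)
  thus ?thesis using S by (auto simp: adjoint_pair_def)
qed

lemma
  assumes "bounded_clinear T"
  shows bounded_clinear_cadjoint: "bounded_clinear (cadjoint T)"
    and adjoint_pair_cadjoint: "adjoint_pair T (cadjoint T)"
proof -
  have "\<exists>!S. bounded_clinear S \<and> adjoint_pair T S"
    using adjoint_exists[OF assms] adjoint_pair_unique by blast
  from theI'[OF this] show "bounded_clinear (cadjoint T)" "adjoint_pair T (cadjoint T)"
    unfolding cadjoint_def adjoint_pair_def by blast+
qed

lemma cadjoint_cadjoint: "bounded_clinear T \<Longrightarrow> cadjoint (cadjoint T) = T"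
  by (meson adjoint_pair_cadjoint adjoint_pair_sym adjoint_pair_unique bounded_clinear_cadjoint)

lemma bounded_below_invertible_operator:
  assumes "invertible_operator T"
  shows "bounded_below T"
proof -
  obtain S where S: "bounded_clinear S" "S \<circ> T = id" using assms by (auto simp: invertible_operator_def)
  have "1 / (onorm S + 1) * norm x \<le> norm (T x)" for x
  proof -
    have "norm x = norm (S (T x))" using S(2) by (metis comp_apply id_apply)
    also have "\<dots> \<le> (onorm S + 1) * norm (T x)"
      using bounded_clinear_norm_le[OF S(1), of "T x"] by (simp add: algebra_simps add_increasing)
    finally show ?thesis
      using bounded_clinear_onorm_nonneg[OF S(1)] by (simp add: field_simps)
  qed
  moreover have "1 / (onorm S + 1) > 0" using bounded_clinear_onorm_nonneg[OF S(1)] by simp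
  ultimately show ?thesis unfolding bounded_below_def by blast
qed

text \<open>Representing the functional \<open>v \<mapsto> \<langle>v, y\<rangle>\<close> as \<open>\<langle>T\<^sup>* v, T\<^sup>* z\<rangle>\<close> gives \<open>y = T T\<^sup>* z\<close>, so \<open>T\<close> is onto.  The
  criterion takes the place of Neumann series in locating the spectrum.\<close>

lemma invertible_operator_if_bounded_below:
  assumes T: "bounded_clinear T" and S: "bounded_clinear S" and adj: "adjoint_pair T S"
    and bT: "bounded_below T" and bS: "bounded_below S"
  shows "invertible_operator T"
proof -
  obtain \<delta> where \<delta>: "\<delta> > 0" "\<And>x. \<delta> * norm x \<le> norm (T x)"
    using bT by (auto simp: bounded_below_def)
  have "\<exists>u. T u = y" for y
  proof -
    have "\<exists>z. \<forall>x. cinner x y = cinner (S x) (S z)"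
      by (rule Riesz_representation_bounded_below[OF S bS, where K = "norm y"])
        (use cinner_Cauchy_Schwarz in \<open>auto simp: cinner_simps mult.commute\<close>)
    then obtain z where "\<And>x. cinner x y = cinner (S x) (S z)" by blast
    hence "y = T (S z)"
      by (intro cinner_left_eqI) (simp add: adjoint_pairD[OF adjoint_pair_sym[OF adj]])
    thus ?thesis by blast
  qed
  then obtain V where V: "\<And>y. T (V y) = y" by metis
  have inj: "x = y" if "T x = T y" for x y
    using \<delta>(2)[of "x - y"] \<delta>(1) that
    by (simp add: bounded_clinear_diff[OF T] mult_le_0_iff)
  have "bounded_clinear V"
  proof (rule bounded_clinearI[where K = "1 / \<delta>"])
    show "norm (V x) \<le> 1 / \<delta> * norm x" for x
      using \<delta>(2)[of "V x"] \<delta>(1) by (simp add: V field_simps)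
  qed (rule inj; simp add: V bounded_clinear_simps[OF T])+
  moreover have "V (T x) = x" for x by (rule inj) (rule V)
  hence "V \<circ> T = id" "T \<circ> V = id" by (simp_all add: V fun_eq_iff)
  ultimately show ?thesis by (auto simp: invertible_operator_def)
qed

lemma invertible_operator_compose:
  assumes "invertible_operator S" "invertible_operator T"
  shows "invertible_operator (\<lambda>x. S (T x))"
proof -
  obtain S' where S: "bounded_clinear S'" "\<And>x. S' (S x) = x" "\<And>x. S (S' x) = x"
    using assms(1) by (auto simp: invertible_operator_def fun_eq_iff)
  obtain T' where T: "bounded_clinear T'" "\<And>x. T' (T x) = x" "\<And>x. T (T' x) = x"
    using assms(2) by (auto simp: invertible_operator_def fun_eq_iff)
  show ?thesis unfolding invertible_operator_def
    by (rule exI[of _ "\<lambda>x. T' (S' x)"])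
      (use S T in \<open>auto intro: bounded_clinear_compose simp: fun_eq_iff\<close>)
qed

lemma invertible_operator_scaleC:
  assumes "c \<noteq> 0"
  shows "invertible_operator (\<lambda>x. c *\<^sub>C x)"
  unfolding invertible_operator_def
  by (rule exI[of _ "\<lambda>x. (1/c) *\<^sub>C x"])
    (use assms in \<open>auto simp: fun_eq_iff scaleC_scaleC bounded_clinear_scaleC_const\<close>)

lemma invertible_operator_uminus_iff:
  "invertible_operator (\<lambda>x. c *\<^sub>C x - T x) \<longleftrightarrow> invertible_operator (\<lambda>x. T x - c *\<^sub>C x)"
  using invertible_operator_compose[OF invertible_operator_scaleC[of "-1"], of "\<lambda>x. T x - c *\<^sub>C x"]
    invertible_operator_compose[OF invertible_operator_scaleC[of "-1"], of "\<lambda>x. c *\<^sub>C x - T x"]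
  by (auto simp: scaleC_minus_one)

text \<open>If \<open>V\<close> inverts \<open>c - S T\<close>, then \<open>(I + T V S) / c\<close> inverts \<open>c - T S\<close>.\<close>

lemma spectrum_commute:
  assumes S: "bounded_clinear S" and T: "bounded_clinear T"
    and c: "c \<in> spectrum (\<lambda>x. T (S x))" "c \<noteq> 0"
  shows "c \<in> spectrum (\<lambda>x. S (T x))"
proof (rule ccontr)
  assume "c \<notin> spectrum (\<lambda>x. S (T x))"
  then obtain V where V: "bounded_clinear V" "\<And>x. V (c *\<^sub>C x - S (T x)) = x"
      "\<And>x. c *\<^sub>C V x - S (T (V x)) = x"
    by (auto simp: spectrum_def invertible_operator_def fun_eq_iff)
  note [simp] = bounded_clinear_simps[OF S] bounded_clinear_simps[OF T] bounded_clinear_simps[OF V(1)]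
  have "invertible_operator (\<lambda>x. c *\<^sub>C x - T (S x))"
    unfolding invertible_operator_def
  proof (rule exI[of _ "\<lambda>x. (1/c) *\<^sub>C (x + T (V (S x)))"], intro conjI)
    show "bounded_clinear (\<lambda>x. (1/c) *\<^sub>C (x + T (V (S x))))"
      by (intro bounded_clinear_compose[OF bounded_clinear_scaleC_const] bounded_clinear_sum_ops
          bounded_clinear_id bounded_clinear_compose[OF T] bounded_clinear_compose[OF V(1)] S)
    have "T (V (S (c *\<^sub>C x - T (S x)))) = T (S x)" for x
      using V(2)[of "S x"] by simp
    thus "(\<lambda>x. (1/c) *\<^sub>C (x + T (V (S x)))) \<circ> (\<lambda>x. c *\<^sub>C x - T (S x)) = id"
      using c(2) by (simp add: fun_eq_iff scaleC_add_right scaleC_diff_right scaleC_scaleC)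
    have "T (c *\<^sub>C V (S x)) - T (S (T (V (S x)))) = T (S x)" for x
      using arg_cong[OF V(3)[of "S x"], of T] by simp
    hence *: "c *\<^sub>C T (V (S x)) = T (S x) + T (S (T (V (S x))))" for x
      by (simp add: diff_eq_eq add.commute)
    have "(c *\<^sub>C ((1/c) *\<^sub>C (x + T (V (S x)))) - T (S ((1/c) *\<^sub>C (x + T (V (S x)))))) = x" for x
    proof -
      have "T (S ((1/c) *\<^sub>C (x + T (V (S x))))) = (1/c) *\<^sub>C (T (S x) + T (S (T (V (S x)))))"
        by simp
      also have "\<dots> = T (V (S x))" using c(2) by (simp add: *[symmetric] scaleC_scaleC)
      finally show ?thesis using c(2) by (simp add: scaleC_scaleC)
    qed
    thus "(\<lambda>x. c *\<^sub>C x - T (S x)) \<circ> (\<lambda>x. (1/c) *\<^sub>C (x + T (V (S x)))) = id"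
      by (simp add: fun_eq_iff)
  qed
  thus False using c(1) by (simp add: spectrum_def)
qed

text \<open>The hypothesis says that \<open>c\<close> has distance at least \<open>d\<close> from the numerical range of \<open>T\<close>.  The
  same lower bound then holds for the adjoint of \<open>c - T\<close>, so both operators are bounded below.\<close>

lemma not_in_spectrum_if_coercive:
  assumes T: "bounded_clinear T" and d: "d > 0"
    and lower: "\<And>x. d * (norm x)\<^sup>2 \<le> cmod (cinner (c *\<^sub>C x - T x) x)"
  shows "c \<notin> spectrum T"
proof -
  define S where "S = cadjoint T"
  have S: "bounded_clinear S" "adjoint_pair T S"
    using T by (simp_all add: S_def bounded_clinear_cadjoint adjoint_pair_cadjoint)
  have bb: "bounded_below U" if "\<And>x. d * (norm x)\<^sup>2 \<le> cmod (cinner (U x) x)" for U :: "'a \<Rightarrow> 'a"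
  proof -
    have "d * norm x \<le> norm (U x)" for x
      using order_trans[OF that[of x] cinner_Cauchy_Schwarz[of "U x" x]]
      by (cases "x = 0") (auto simp: power2_eq_square mult.assoc[symmetric])
    thus ?thesis using d by (auto simp: bounded_below_def)
  qed
  have "adjoint_pair (\<lambda>x. c *\<^sub>C x - T x) (\<lambda>x. cnj c *\<^sub>C x - S x)"
    by (simp add: adjoint_pair_def cinner_simps adjoint_pairD[OF S(2)])
  moreover have "bounded_below (\<lambda>x. c *\<^sub>C x - T x)" by (intro bb lower)
  moreover have "bounded_below (\<lambda>x. cnj c *\<^sub>C x - S x)"
  proof (rule bb)
    fix x
    have "cinner x (cnj c *\<^sub>C x - S x) = cinner (c *\<^sub>C x - T x) x"
      by (simp add: cinner_simps adjoint_pairD[OF S(2)])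
    thus "d * (norm x)\<^sup>2 \<le> cmod (cinner (cnj c *\<^sub>C x - S x) x)"
      using lower[of x] by (simp add: cmod_cinner_commute[of "cnj c *\<^sub>C x - S x"])
  qed
  ultimately have "invertible_operator (\<lambda>x. c *\<^sub>C x - T x)"
    by (rule invertible_operator_if_bounded_below[rotated 2])
      (auto intro!: bounded_clinear_intros T S(1))
  thus ?thesis by (simp add: spectrum_def)
qed

lemma spectrum_bounded:
  assumes T: "bounded_clinear T" and c: "c \<in> spectrum T"
  shows "cmod c \<le> onorm T"
proof (rule ccontr)
  assume less: "\<not> cmod c \<le> onorm T"
  have "(cmod c - onorm T) * (norm x)\<^sup>2 \<le> cmod (cinner (c *\<^sub>C x - T x) x)" for x
  proof -
    have "cmod (cinner (T x) x) \<le> onorm T * (norm x)\<^sup>2"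
      using cmod_cinner_operator_le[OF T, of x x] by (simp add: power2_eq_square mult.assoc)
    moreover have "cmod (cinner (c *\<^sub>C x) x) = cmod c * (norm x)\<^sup>2"
      by (simp add: cinner_simps cinner_self norm_mult norm_power)
    ultimately show ?thesis
      using norm_triangle_ineq2[of "cinner (c *\<^sub>C x) x" "cinner (T x) x"]
      by (simp add: cinner_diff_left algebra_simps)
  qed
  with not_in_spectrum_if_coercive[OF T, of "cmod c - onorm T" c] less c show False by simp
qed

lemma cmod_le_spectral_radius:
  assumes "bounded_clinear T" "c \<in> spectrum T"
  shows "cmod c \<le> spectral_radius T"
  unfolding spectral_radius_def
proof (rule cSup_upper)
  show "bdd_above (insert 0 {cmod c |c. c \<in> spectrum T})"
    using spectrum_bounded[OF assms(1)] by (auto intro!: bdd_aboveI[of _ "onorm T"])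
qed (use assms(2) in auto)

lemma spectral_radius_nonneg:
  assumes "bounded_clinear T"
  shows "0 \<le> spectral_radius T"
  unfolding spectral_radius_def
proof (rule cSup_upper)
  show "bdd_above (insert 0 {cmod c |c. c \<in> spectrum T})"
    using spectrum_bounded[OF assms(1)] by (auto intro!: bdd_aboveI[of _ "onorm T"])
qed simp

section \<open>Polynomials in an operator\<close>

text \<open>Complex coefficients serve to split real polynomials into linear factors.\<close>

definition cpoly_operator :: "complex poly \<Rightarrow> ('a::chilbert_space \<Rightarrow> 'a) \<Rightarrow> 'a \<Rightarrow> 'a" where
  "cpoly_operator p T = (\<lambda>x. \<Sum>i\<le>degree p. coeff p i *\<^sub>C (T ^^ i) x)"

lemma cpoly_operator_altdef:
  assumes "degree p \<le> n"
  shows "cpoly_operator p T x = (\<Sum>i\<le>n. coeff p i *\<^sub>C (T ^^ i) x)"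
  unfolding cpoly_operator_def
  by (rule sum.mono_neutral_left) (use assms in \<open>auto simp: coeff_eq_0\<close>)

lemma poly_operator_conv_cpoly:
  "poly_operator p T x = cpoly_operator (map_poly complex_of_real p) T x"
  by (simp add: poly_operator_def cpoly_operator_def degree_map_poly coeff_map_poly scaleR_scaleC)

lemma cpoly_operator_add: "cpoly_operator (p + q) T x = cpoly_operator p T x + cpoly_operator q T x"
proof -
  define n where "n = max (degree p) (degree q)"
  have "degree p \<le> n" "degree q \<le> n" "degree (p + q) \<le> n"
    by (simp_all add: n_def degree_add_le)
  thus ?thesis by (simp add: cpoly_operator_altdef scaleC_add_left sum.distrib)
qed

lemma cpoly_operator_smult: "cpoly_operator (smult c p) T x = c *\<^sub>C cpoly_operator p T x"
  by (simp add: cpoly_operator_altdef[OF degree_smult_le] cpoly_operator_def scaleC_sum_right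
      scaleC_scaleC)

lemma cpoly_operator_pCons:
  assumes "bounded_clinear T"
  shows "cpoly_operator (pCons c p) T x = c *\<^sub>C x + T (cpoly_operator p T x)"
proof -
  interpret bounded_linear T by (rule bounded_clinear_imp_bounded_linear[OF assms])
  have "cpoly_operator (pCons c p) T x
      = (\<Sum>i\<le>Suc (degree p). coeff (pCons c p) i *\<^sub>C (T ^^ i) x)"
    by (rule cpoly_operator_altdef) (rule degree_pCons_le)
  also have "\<dots> = c *\<^sub>C x + (\<Sum>i\<le>degree p. coeff p i *\<^sub>C T ((T ^^ i) x))"
    by (simp add: sum.atMost_Suc_shift del: sum.atMost_Suc)
  also have "(\<Sum>i\<le>degree p. coeff p i *\<^sub>C T ((T ^^ i) x)) = T (cpoly_operator p T x)"
    by (simp add: cpoly_operator_def sum bounded_clinear_scaleC[OF assms])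
  finally show ?thesis .
qed

lemma cpoly_operator_0 [simp]: "cpoly_operator 0 T x = 0"
  by (simp add: cpoly_operator_def)

lemma cpoly_operator_mult:
  assumes "bounded_clinear T"
  shows "cpoly_operator (p * q) T x = cpoly_operator p T (cpoly_operator q T x)"
  by (induction p)
    (simp_all add: mult_pCons_left cpoly_operator_add cpoly_operator_smult
      cpoly_operator_pCons[OF assms])

lemma poly_operator_0 [simp]: "poly_operator 0 T x = 0"
  by (simp add: poly_operator_def)

lemma poly_operator_pCons:
  assumes "bounded_clinear T"
  shows "poly_operator (pCons a p) T x = a *\<^sub>R x + T (poly_operator p T x)"
proof -
  have "map_poly complex_of_real (pCons a p) = pCons (complex_of_real a) (map_poly of_real p)"
    by (simp add: poly_eq_iff coeff_map_poly coeff_pCons split: nat.split)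
  thus ?thesis
    by (simp add: poly_operator_conv_cpoly cpoly_operator_pCons[OF assms] scaleR_scaleC)
qed

lemma poly_operator_add: "poly_operator (p + q) T x = poly_operator p T x + poly_operator q T x"
proof -
  have "map_poly complex_of_real (p + q) = map_poly of_real p + map_poly of_real q"
    by (simp add: poly_eq_iff coeff_map_poly)
  thus ?thesis by (simp add: poly_operator_conv_cpoly cpoly_operator_add)
qed

lemma poly_operator_diff: "poly_operator (p - q) T x = poly_operator p T x - poly_operator q T x"
  using poly_operator_add[of "p - q" q T x] by simp

lemma poly_operator_mult:
  assumes "bounded_clinear T"
  shows "poly_operator (p * q) T x = poly_operator p T (poly_operator q T x)"
proof -
  have "map_poly complex_of_real (p * q) = map_poly of_real p * map_poly of_real q"
    by (simp add: poly_eq_iff coeff_map_poly coeff_mult)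
  thus ?thesis by (simp add: poly_operator_conv_cpoly cpoly_operator_mult[OF assms])
qed

lemma bounded_clinear_poly_operator:
  assumes "bounded_clinear T"
  shows "bounded_clinear (poly_operator p T)"
proof (induction p)
  case (pCons a p)
  have "poly_operator (pCons a p) T = (\<lambda>x. complex_of_real a *\<^sub>C x + T (poly_operator p T x))"
    by (rule ext) (simp add: poly_operator_pCons[OF assms] scaleR_scaleC)
  thus ?case
    by (simp add: bounded_clinear_sum_ops bounded_clinear_scaleC_const
        bounded_clinear_compose[OF assms pCons.IH])
qed (simp add: poly_operator_def bounded_clinear_null)

lemma poly_operator_intertwine:
  assumes "bounded_clinear A" "bounded_clinear S" "bounded_clinear T" "\<And>x. A (T x) = S (A x)"
  shows "A (poly_operator p T x) = poly_operator p S (A x)"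
  by (induction p)
    (simp_all add: poly_operator_pCons assms bounded_clinear_simps[OF assms(1)])

lemma adjoint_pair_poly_operator:
  assumes "bounded_clinear T" "bounded_clinear S" "adjoint_pair T S"
  shows "adjoint_pair (poly_operator p T) (poly_operator p S)"
proof (induction p)
  case (pCons a p)
  have "S (poly_operator p S y) = poly_operator p S (S y)" for y
    by (rule poly_operator_intertwine) (use assms in auto)
  thus ?case using pCons.IH assms
    by (simp add: adjoint_pair_def poly_operator_pCons cinner_simps)
qed (simp add: adjoint_pair_def)

text \<open>By the fundamental theorem of algebra \<open>p(T)\<close> is a nonzero multiple of a product of factors
  \<open>T - z\<close> with \<open>p(z) = 0\<close>.\<close>

lemma invertible_cpoly_operator:
  assumes T: "bounded_clinear T" and "p \<noteq> 0" "\<And>z. poly p z = 0 \<Longrightarrow> z \<notin> spectrum T"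
  shows "invertible_operator (cpoly_operator p T)"
  using assms(2,3)
proof (induction "degree p" arbitrary: p rule: less_induct)
  case less
  show ?case
  proof (cases "degree p = 0")
    case True
    then obtain c where p: "p = [:c:]" using degree_eq_zeroE by blast
    hence "cpoly_operator p T = (\<lambda>x. c *\<^sub>C x)"
      by (simp add: fun_eq_iff cpoly_operator_def)
    thus ?thesis using less.prems(1) p by (simp add: invertible_operator_scaleC)
  next
    case False
    hence "\<not> constant (poly p)" by (simp add: constant_degree)
    then obtain z where z: "poly p z = 0" using fundamental_theorem_of_algebra by blast
    then obtain q where q: "p = [:-z, 1:] * q" by (meson poly_eq_0_iff_dvd dvdE)
    have "q \<noteq> 0" using less.prems(1) q by auto
    hence "degree q < degree p" using q by (simp add: degree_mult_eq del: mult_pCons_left)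
    hence inv: "invertible_operator (cpoly_operator q T)"
      using less.hyps \<open>q \<noteq> 0\<close> less.prems(2) q by auto
    have "p = smult (- z) q + pCons 0 q" by (simp add: q)
    hence "cpoly_operator p T x = T (cpoly_operator q T x) - z *\<^sub>C cpoly_operator q T x" for x
      by (simp only: cpoly_operator_add cpoly_operator_smult cpoly_operator_pCons[OF T])
        (simp add: scaleC_minus_left)
    moreover have "invertible_operator (\<lambda>x. T x - z *\<^sub>C x)"
      using less.prems(2)[OF z] by (simp add: spectrum_def invertible_operator_uminus_iff)
    ultimately show ?thesis
      using invertible_operator_compose[OF _ inv, of "\<lambda>x. T x - z *\<^sub>C x"] by presburger
  qed
qed

section \<open>Norms and spectra of self-adjoint operators\<close>

definition selfadjoint :: "('a::chilbert_space \<Rightarrow> 'a) \<Rightarrow> bool" where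
  "selfadjoint T \<longleftrightarrow> bounded_clinear T \<and> adjoint_pair T T"

definition real_spectrum :: "('a::chilbert_space \<Rightarrow> 'a) \<Rightarrow> real set" where
  "real_spectrum T = {t. complex_of_real t \<in> spectrum T}"

lemma selfadjointD:
  assumes "selfadjoint T"
  shows "bounded_clinear T" "cinner (T x) y = cinner x (T y)"
  using assms by (auto simp: selfadjoint_def adjoint_pair_def)

lemma selfadjoint_poly_operator: "selfadjoint T \<Longrightarrow> selfadjoint (poly_operator p T)"
  by (simp add: selfadjoint_def bounded_clinear_poly_operator adjoint_pair_poly_operator)

lemma Im_cinner_selfadjoint:
  assumes "selfadjoint T"
  shows "Im (cinner (T x) x) = 0"
  using selfadjointD(2)[OF assms, of x x] cinner_commute[of "T x" x]
  by (simp add: complex_eq_iff)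

lemma spectrum_selfadjoint_real:
  assumes T: "selfadjoint T" and z: "z \<in> spectrum T"
  shows "Im z = 0"
proof (rule ccontr)
  assume *: "Im z \<noteq> 0"
  have "\<bar>Im z\<bar> * (norm x)\<^sup>2 \<le> cmod (cinner (z *\<^sub>C x - T x) x)" for x
  proof -
    have "Im (cinner (z *\<^sub>C x - T x) x) = Im z * (norm x)\<^sup>2"
      by (simp add: cinner_simps cinner_self Im_cinner_selfadjoint[OF T] flip: of_real_power)
    thus ?thesis using abs_Im_le_cmod[of "cinner (z *\<^sub>C x - T x) x"] by (simp add: abs_mult)
  qed
  with not_in_spectrum_if_coercive[OF selfadjointD(1)[OF T], of "\<bar>Im z\<bar>" z] * z show False by simp
qed

text \<open>If \<open>\<parallel>S x\<^sub>n\<parallel>\<close> tends to \<open>\<parallel>S\<parallel>\<close> along unit vectors, then the \<open>x\<^sub>n\<close> are approximate eigenvectors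
  of \<open>S\<^sup>2\<close> for \<open>\<parallel>S\<parallel>\<^sup>2\<close>.\<close>

lemma not_invertible_onorm_square_minus_square:
  fixes S :: "'a::chilbert_space \<Rightarrow> 'a"
  assumes S: "selfadjoint S" and nz: "\<exists>x::'a. x \<noteq> 0"
  shows "\<not> invertible_operator (\<lambda>x. (onorm S)\<^sup>2 *\<^sub>R x - S (S x))"
proof
  define N where "N = onorm S"
  note bS = selfadjointD(1)[OF S]
  have N0: "N \<ge> 0" using bounded_clinear_onorm_nonneg[OF bS] by (simp add: N_def)
  assume "invertible_operator (\<lambda>x. (onorm S)\<^sup>2 *\<^sub>R x - S (S x))"
  then obtain \<delta> where \<delta>: "\<delta> > 0" "\<And>x. \<delta> * norm x \<le> norm (N\<^sup>2 *\<^sub>R x - S (S x))"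
    using bounded_below_invertible_operator unfolding bounded_below_def N_def by blast
  have le: "N\<^sup>2 * (norm (S x))\<^sup>2 \<le> (N ^ 4 - \<delta>\<^sup>2) * (norm x)\<^sup>2" for x
  proof -
    have "\<delta>\<^sup>2 * (norm x)\<^sup>2 \<le> (norm (N\<^sup>2 *\<^sub>R x - S (S x)))\<^sup>2"
      using power_mono[OF \<delta>(2)[of x], of 2] \<delta>(1) by (simp add: power_mult_distrib)
    also have "\<dots> = N ^ 4 * (norm x)\<^sup>2 + (norm (S (S x)))\<^sup>2 - 2 * (N\<^sup>2 * (norm (S x))\<^sup>2)"
    proof -
      have "Re (cinner (N\<^sup>2 *\<^sub>R x) (S (S x))) = N\<^sup>2 * (norm (S x))\<^sup>2"
        by (simp add: cinner_scaleR_left selfadjointD(2)[OF S, of x "S x"] power2_norm_eq_Re_cinner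
            flip: of_real_power)
      thus ?thesis by (simp add: power2_norm_diff power_mult_distrib)
    qed
    also have "(norm (S (S x)))\<^sup>2 \<le> N\<^sup>2 * (norm (S x))\<^sup>2"
      using power_mono[OF bounded_clinear_norm_le[OF bS, of "S x"], of 2]
      by (simp add: power_mult_distrib N_def)
    finally show ?thesis by (simp add: algebra_simps)
  qed
  \<comment> \<open>So \<open>\<parallel>S x\<parallel>\<close> stays below \<open>\<surd>(N\<^sup>4 - \<delta>\<^sup>2) / N < N\<close> on unit vectors.\<close>
  obtain x0 :: 'a where x0: "x0 \<noteq> 0" using nz by blast
  have "0 \<le> (N ^ 4 - \<delta>\<^sup>2) * (norm x0)\<^sup>2"
    by (rule order_trans[OF _ le]) simp
  hence nn: "0 \<le> N ^ 4 - \<delta>\<^sup>2" using x0 by (simp add: zero_le_mult_iff)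
  hence "0 < N ^ 4" using \<delta>(1) by (smt (verit) zero_less_power2)
  hence N: "N > 0" using N0 by (cases "N = 0") auto
  have "norm (S x) \<le> sqrt (N ^ 4 - \<delta>\<^sup>2) / N * norm x" for x
  proof (rule power2_le_imp_le)
    show "(norm (S x))\<^sup>2 \<le> (sqrt (N ^ 4 - \<delta>\<^sup>2) / N * norm x)\<^sup>2"
      using le[of x] N nn by (simp add: power_mult_distrib power_divide field_simps)
  qed (use N nn in simp)
  hence "N \<le> sqrt (N ^ 4 - \<delta>\<^sup>2) / N"
    using onorm_bound[of "sqrt (N ^ 4 - \<delta>\<^sup>2) / N" S] N nn by (simp add: N_def)
  hence "N\<^sup>2 \<le> sqrt (N ^ 4 - \<delta>\<^sup>2)" using N by (simp add: field_simps power2_eq_square)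
  hence "(N\<^sup>2)\<^sup>2 \<le> N ^ 4 - \<delta>\<^sup>2" using nn by (metis zero_le_power2 power_mono real_sqrt_pow2)
  thus False using \<delta>(1) by simp
qed

text \<open>The spectral root supplied by the complex factorisation is real, since the spectrum is.\<close>

lemma root_in_spectrum:
  assumes T: "selfadjoint T" and "q \<noteq> 0" and "\<not> invertible_operator (poly_operator q T)"
  shows "\<exists>t\<in>real_spectrum T. poly q t = 0"
proof -
  let ?q = "map_poly complex_of_real q"
  have "?q \<noteq> 0" using assms(2) by (simp add: map_poly_eq_0_iff)
  moreover have "poly_operator q T = cpoly_operator ?q T"
    by (simp add: fun_eq_iff poly_operator_conv_cpoly)
  ultimately obtain z where z: "poly ?q z = 0" "z \<in> spectrum T"
    using invertible_cpoly_operator[OF selfadjointD(1)[OF T]] assms(3) by metis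
  have zr: "z = complex_of_real (Re z)"
    using spectrum_selfadjoint_real[OF T z(2)] by (simp add: complex_eq_iff)
  have "poly ?q (complex_of_real t) = complex_of_real (poly q t)" for t
    by (induction q) (simp_all add: map_poly_pCons)
  hence "complex_of_real (poly q (Re z)) = 0" using z(1) zr by metis
  moreover have "Re z \<in> real_spectrum T" using z(2) zr by (simp add: real_spectrum_def)
  ultimately show ?thesis by auto
qed

text \<open>Inserting \<open>T\<close> into the polynomial \<open>\<parallel>p(T)\<parallel>\<^sup>2 - p\<^sup>2\<close> yields a non-invertible operator, so the
  polynomial, unless it is zero, has a root in the spectrum.\<close>

lemma onorm_poly_operator_attained:
  fixes T :: "'a::chilbert_space \<Rightarrow> 'a"
  assumes T: "selfadjoint T" and nz: "\<exists>x::'a. x \<noteq> 0"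
  shows "\<exists>t\<in>real_spectrum T. \<bar>poly p t\<bar> = onorm (poly_operator p T)"
proof -
  note bT = selfadjointD(1)[OF T]
  define q where "q = (\<lambda>p. [:(onorm (poly_operator p T))\<^sup>2:] - p * p)"
  have root: "\<exists>t\<in>real_spectrum T. poly (q p) t = 0" if "q p \<noteq> 0" for p
  proof (rule root_in_spectrum[OF T that])
    have "poly_operator (q p) T = (\<lambda>x. (onorm (poly_operator p T))\<^sup>2 *\<^sub>R x
        - poly_operator p T (poly_operator p T x))"
      by (simp add: fun_eq_iff q_def poly_operator_diff poly_operator_mult[OF bT]
          poly_operator_pCons[OF bT] bounded_clinear_zero[OF bT])
    thus "\<not> invertible_operator (poly_operator (q p) T)"
      using not_invertible_onorm_square_minus_square[OF selfadjoint_poly_operator[OF T] nz]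
      by simp
  qed
  have "coeff (q [:0, 1:]) 2 \<noteq> 0" by (simp add: q_def numeral_2_eq_2)
  hence "q [:0, 1:] \<noteq> 0" by force
  \<comment> \<open>The identity polynomial shows that the spectrum is nonempty, as needed when \<open>p\<close> is constant.\<close>
  from root[OF this] obtain t0 where "t0 \<in> real_spectrum T" by blast
  hence "\<exists>t\<in>real_spectrum T. poly (q p) t = 0" using root[of p] by (cases "q p = 0") auto
  then obtain t where t: "t \<in> real_spectrum T" "poly (q p) t = 0" by blast
  hence "(poly p t)\<^sup>2 = (onorm (poly_operator p T))\<^sup>2" by (simp add: q_def power2_eq_square)
  hence "\<bar>poly p t\<bar> = onorm (poly_operator p T)"
    using bounded_clinear_onorm_nonneg[OF bounded_clinear_poly_operator[OF bT], of p]
    by (metis abs_of_nonneg power2_eq_iff abs_minus)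
  thus ?thesis using t(1) by blast
qed

lemma onorm_poly_operator_le:
  fixes T :: "'a::chilbert_space \<Rightarrow> 'a"
  assumes T: "selfadjoint T" and "\<And>t. t \<in> real_spectrum T \<Longrightarrow> \<bar>poly p t\<bar> \<le> C" and "0 \<le> C"
  shows "onorm (poly_operator p T) \<le> C"
proof (cases "\<exists>x::'a. x \<noteq> 0")
  case True
  thus ?thesis using onorm_poly_operator_attained[OF T, of p] assms(2) by metis
next
  case False
  hence "norm (poly_operator p T x) \<le> C * norm x" for x
    by (metis norm_zero mult_zero_right order_refl)
  thus ?thesis by (intro onorm_bound assms(3))
qed

section \<open>The continuous functional calculus\<close>

text \<open>If \<open>p\<^sub>n\<close> converges to \<open>f\<close> uniformly on the spectrum, then \<open>p\<^sub>n(T)\<close> is Cauchy in norm, because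
  \<open>\<parallel>p\<^sub>n(T) - p\<^sub>m(T)\<parallel>\<close> is at most the supremum of \<open>\<bar>p\<^sub>n - p\<^sub>m\<bar>\<close> there; for the same reason the limit is
  independent of the approximating sequence.\<close>

lemma cont_fun_calc_limit:
  fixes T :: "'a::chilbert_space \<Rightarrow> 'a"
  assumes T: "selfadjoint T"
    and ex: "\<exists>p. uniform_limit (real_spectrum T) (\<lambda>n. poly (p n)) f sequentially"
  shows "bounded_clinear (cont_fun_calc f T)"
    and "uniform_limit (real_spectrum T) (\<lambda>n. poly (p n)) f sequentially \<Longrightarrow>
      (\<lambda>n. onorm (\<lambda>x. poly_operator (p n) T x - cont_fun_calc f T x)) \<longlonglongrightarrow> 0"
proof -
  define lim where "lim = (\<lambda>p. uniform_limit (real_spectrum T) (\<lambda>n. poly (p n)) f sequentially)"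
  have lim_iff: "uniform_limit (real_spectrum T) (\<lambda>n. poly (p n)) f sequentially \<longleftrightarrow> lim p" for p
    by (simp add: lim_def)
  note bT = selfadjointD(1)[OF T]
  note bp = bounded_clinear_poly_operator[OF bT]
  have diff_le: "onorm (\<lambda>x. poly_operator p T x - poly_operator q T x) \<le> e"
    if "\<And>t. t \<in> real_spectrum T \<Longrightarrow> dist (poly p t) (f t) < e/2"
      "\<And>t. t \<in> real_spectrum T \<Longrightarrow> dist (poly q t) (f t) < e/2" "e \<ge> 0" for p q e
  proof -
    have "onorm (poly_operator (p - q) T) \<le> e"
    proof (rule onorm_poly_operator_le[OF T _ that(3)])
      fix t assume "t \<in> real_spectrum T"
      thus "\<bar>poly (p - q) t\<bar> \<le> e"
        using that(1)[of t] that(2)[of t] unfolding dist_real_def poly_diff by linarith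
    qed
    thus ?thesis by (simp add: poly_operator_diff[abs_def])
  qed
  obtain p0 where p0: "lim p0" using ex by (auto simp: lim_def)
  define X where "X = (\<lambda>n. Blinfun (poly_operator (p0 n) T))"
  have X: "blinfun_apply (X n) = poly_operator (p0 n) T" for n
    unfolding X_def by (rule bounded_linear_Blinfun_apply)
      (rule bounded_clinear_imp_bounded_linear[OF bp])
  have "Cauchy X"
  proof (rule metric_CauchyI)
    fix e :: real assume e: "e > 0"
    have "\<forall>\<^sub>F n in sequentially. \<forall>t\<in>real_spectrum T. dist (poly (p0 n) t) (f t) < e/4"
      using p0 e unfolding lim_def by (intro uniform_limitD) auto
    then obtain N where N: "\<And>n t. n \<ge> N \<Longrightarrow> t \<in> real_spectrum T \<Longrightarrow> dist (poly (p0 n) t) (f t) < e/4"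
      unfolding eventually_sequentially by blast
    have "dist (X i) (X j) < e" if "i \<ge> N" "j \<ge> N" for i j
      using diff_le[of "p0 i" "e/2" "p0 j"] N that e
      by (simp add: dist_norm norm_blinfun.rep_eq minus_blinfun.rep_eq X)
    thus "\<exists>M. \<forall>m\<ge>M. \<forall>n\<ge>M. dist (X m) (X n) < e" by blast
  qed
  then obtain L where L: "X \<longlonglongrightarrow> L" using Cauchy_convergent_iff convergent_def by blast
  define S where "S = blinfun_apply L"
  have S_lim: "(\<lambda>n. poly_operator (p0 n) T x) \<longlonglongrightarrow> S x" for x
    using blinfun.tendsto[OF L tendsto_const[of x]] by (simp add: X S_def)
  have S_scale: "S (c *\<^sub>C x) = c *\<^sub>C S x" for c x
  proof (rule LIMSEQ_unique[OF S_lim])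
    have "bounded_linear (\<lambda>x::'a. c *\<^sub>C x)"
      by (rule bounded_clinear_imp_bounded_linear[OF bounded_clinear_scaleC_const])
    from bounded_linear.tendsto[OF this S_lim]
    show "(\<lambda>n. poly_operator (p0 n) T (c *\<^sub>C x)) \<longlonglongrightarrow> c *\<^sub>C S x"
      by (simp add: bounded_clinear_scaleC[OF bp])
  qed
  hence bS: "bounded_clinear S"
    by (simp add: bounded_clinear_def S_def blinfun.bounded_linear_right)
  have S_onorm: "(\<lambda>n. onorm (\<lambda>x. poly_operator (p0 n) T x - S x)) \<longlonglongrightarrow> 0"
    using tendsto_norm_zero[OF LIM_zero[OF L]]
    by (simp add: norm_blinfun.rep_eq minus_blinfun.rep_eq X S_def)
  have S_all: "(\<lambda>n. onorm (\<lambda>x. poly_operator (p n) T x - S x)) \<longlonglongrightarrow> 0" if p: "lim p" for p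
  proof -
    have "(\<lambda>n. onorm (\<lambda>x. poly_operator (p n) T x - poly_operator (p0 n) T x)) \<longlonglongrightarrow> 0"
    proof (rule tendstoI)
      fix e :: real assume e: "e > 0"
      have "\<forall>\<^sub>F n in sequentially. \<forall>t\<in>real_spectrum T. dist (poly (p0 n) t) (f t) < e/4"
        "\<forall>\<^sub>F n in sequentially. \<forall>t\<in>real_spectrum T. dist (poly (p n) t) (f t) < e/4"
        using uniform_limitD[OF p0[unfolded lim_def], of "e/4"]
          uniform_limitD[OF p[unfolded lim_def], of "e/4"] e by simp_all
      thus "\<forall>\<^sub>F n in sequentially.
          dist (onorm (\<lambda>x. poly_operator (p n) T x - poly_operator (p0 n) T x)) 0 < e"
      proof eventually_elim
        case (elim n)
        have "onorm (\<lambda>x. poly_operator (p n) T x - poly_operator (p0 n) T x) \<le> e/2"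
          by (rule diff_le) (use elim e in auto)
        moreover have "0 \<le> onorm (\<lambda>x. poly_operator (p n) T x - poly_operator (p0 n) T x)"
          by (intro bounded_clinear_onorm_nonneg bounded_clinear_sum_ops bp)
        ultimately show ?case using e by (simp add: dist_real_def)
      qed
    qed
    from tendsto_add[OF this S_onorm]
    have sum0: "(\<lambda>n. onorm (\<lambda>x. poly_operator (p n) T x - poly_operator (p0 n) T x)
        + onorm (\<lambda>x. poly_operator (p0 n) T x - S x)) \<longlonglongrightarrow> 0" by simp
    show ?thesis
    proof (rule tendsto_sandwich[OF _ _ tendsto_const sum0]; intro always_eventually allI)
      fix n
      show "0 \<le> onorm (\<lambda>x. poly_operator (p n) T x - S x)"
        by (intro bounded_clinear_onorm_nonneg bounded_clinear_sum_ops bp bS)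
      have "onorm (\<lambda>x. (poly_operator (p n) T x - poly_operator (p0 n) T x)
          + (poly_operator (p0 n) T x - S x))
        \<le> onorm (\<lambda>x. poly_operator (p n) T x - poly_operator (p0 n) T x)
        + onorm (\<lambda>x. poly_operator (p0 n) T x - S x)"
        by (intro onorm_triangle bounded_clinear_imp_bounded_linear bounded_clinear_sum_ops bp bS)
      thus "onorm (\<lambda>x. poly_operator (p n) T x - S x)
        \<le> onorm (\<lambda>x. poly_operator (p n) T x - poly_operator (p0 n) T x)
        + onorm (\<lambda>x. poly_operator (p0 n) T x - S x)" by simp
    qed
  qed
  have eq: "cont_fun_calc f T = S"
    unfolding cont_fun_calc_def real_spectrum_def[symmetric] lim_iff
  proof (rule the_equality)
    show "bounded_clinear S \<and>
      (\<forall>p. lim p \<longrightarrow> (\<lambda>n. onorm (\<lambda>x. poly_operator (p n) T x - S x)) \<longlonglongrightarrow> 0)"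
      using bS S_all by blast
  next
    fix S' assume *: "bounded_clinear S' \<and>
      (\<forall>p. lim p \<longrightarrow> (\<lambda>n. onorm (\<lambda>x. poly_operator (p n) T x - S' x)) \<longlonglongrightarrow> 0)"
    have "(\<lambda>n. poly_operator (p0 n) T x) \<longlonglongrightarrow> S' x" for x
    proof (rule LIM_zero_cancel, rule Lim_null_comparison)
      have "(\<lambda>n. onorm (\<lambda>x. poly_operator (p0 n) T x - S' x)) \<longlonglongrightarrow> 0" using * p0 by blast
      from tendsto_mult_right[OF this, of "norm x"]
      show "(\<lambda>n. onorm (\<lambda>x. poly_operator (p0 n) T x - S' x) * norm x) \<longlonglongrightarrow> 0" by simp
      show "\<forall>\<^sub>F n in sequentially. norm (poly_operator (p0 n) T x - S' x)
          \<le> onorm (\<lambda>x. poly_operator (p0 n) T x - S' x) * norm x"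
        using * by (intro always_eventually allI onorm bounded_clinear_imp_bounded_linear
            bounded_clinear_sum_ops bp) blast
    qed
    thus "S' = S" using S_lim LIMSEQ_unique by blast
  qed
  show "bounded_clinear (cont_fun_calc f T)" using bS eq by simp
  show "(\<lambda>n. onorm (\<lambda>x. poly_operator (p n) T x - cont_fun_calc f T x)) \<longlonglongrightarrow> 0"
    if "uniform_limit (real_spectrum T) (\<lambda>n. poly (p n)) f sequentially"
    using S_all that eq by (simp add: lim_def)
qed

section \<open>Functional calculus of positive operators\<close>

definition positive_operator :: "('a::chilbert_space \<Rightarrow> 'a) \<Rightarrow> bool" where
  "positive_operator P \<longleftrightarrow> selfadjoint P \<and> (\<forall>x. 0 \<le> Re (cinner (P x) x))"

lemma positive_operator_selfadjoint: "positive_operator P \<Longrightarrow> selfadjoint P"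
  by (simp add: positive_operator_def)

lemma positive_operator_bounded_clinear: "positive_operator P \<Longrightarrow> bounded_clinear P"
  by (simp add: positive_operator_def selfadjoint_def)

lemma real_spectrum_positive_operator:
  assumes P: "positive_operator P" and t: "t \<in> real_spectrum P"
  shows "0 \<le> t" "t \<le> onorm P"
proof -
  note bP = positive_operator_bounded_clinear[OF P]
  have ts: "complex_of_real t \<in> spectrum P" using t by (simp add: real_spectrum_def)
  from spectrum_bounded[OF bP this] show "t \<le> onorm P" by simp
  show "0 \<le> t"
  proof (rule ccontr)
    assume neg: "\<not> 0 \<le> t"
    have "- t * (norm x)\<^sup>2 \<le> cmod (cinner (complex_of_real t *\<^sub>C x - P x) x)" for x
    proof -
      have "Re (cinner (complex_of_real t *\<^sub>C x - P x) x) = t * (norm x)\<^sup>2 - Re (cinner (P x) x)"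
        by (simp add: cinner_simps power2_norm_eq_Re_cinner)
      also have "\<dots> \<le> t * (norm x)\<^sup>2" using P by (simp add: positive_operator_def)
      finally show ?thesis
        using abs_Re_le_cmod[of "cinner (complex_of_real t *\<^sub>C x - P x) x"] by linarith
    qed
    with not_in_spectrum_if_coercive[OF bP, of "- t" "complex_of_real t"] neg ts
    show False by simp
  qed
qed

lemma uniform_polynomial_approximation:
  fixes f :: "real \<Rightarrow> real"
  assumes "continuous_on {a..b} f"
  shows "\<exists>p. uniform_limit {a..b} (\<lambda>n. poly (p n)) f sequentially"
proof -
  obtain g where g: "uniform_limit {a..b} g f sequentially" "\<And>n::nat. polynomial_function (g n)"
    using Stone_Weierstrass_uniform_limit[OF compact_Icc assms] by blast
  have "\<exists>p. g n = poly p" for n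
  proof -
    obtain c m where "g n = (\<lambda>x. \<Sum>i\<le>m. c i * x ^ i)"
      using g(2)[of n] by (auto simp: real_polynomial_function_eq[symmetric]
          real_polynomial_function_iff_sum)
    hence "g n = poly (\<Sum>i\<le>m. monom (c i) i)"
      by (simp add: fun_eq_iff poly_sum poly_monom)
    thus ?thesis by blast
  qed
  then obtain p where "\<And>n. g n = poly (p n)" by metis
  hence "g = (\<lambda>n. poly (p n))" by (rule ext)
  with g(1) show ?thesis by blast
qed

text \<open>The spectrum of \<open>P\<close> lies in \<open>[0, \<parallel>P\<parallel>]\<close>, so continuity on the half-line provides approximating
  polynomials for all positive operators at once.  The bound \<open>M\<close> allows one sequence of polynomials
  to be used for two operators.\<close>

lemma
  assumes P: "positive_operator P" and f: "continuous_on {0..} f"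
  shows bounded_clinear_cont_fun_calc: "bounded_clinear (cont_fun_calc f P)"
    and cont_fun_calc_onorm_tendsto:
      "onorm P \<le> M \<Longrightarrow> uniform_limit {0..M} (\<lambda>n. poly (p n)) f sequentially \<Longrightarrow>
        (\<lambda>n. onorm (\<lambda>x. poly_operator (p n) P x - cont_fun_calc f P x)) \<longlonglongrightarrow> 0"
    and cont_fun_calc_tendsto:
      "onorm P \<le> M \<Longrightarrow> uniform_limit {0..M} (\<lambda>n. poly (p n)) f sequentially \<Longrightarrow>
        (\<lambda>n. poly_operator (p n) P x) \<longlonglongrightarrow> cont_fun_calc f P x"
proof -
  note sa = positive_operator_selfadjoint[OF P]
  note bP = positive_operator_bounded_clinear[OF P]
  have sub: "real_spectrum P \<subseteq> {0..onorm P}"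
    using real_spectrum_positive_operator[OF P] by auto
  have "continuous_on {0..onorm P} f" by (rule continuous_on_subset[OF f]) auto
  then obtain p0 where "uniform_limit {0..onorm P} (\<lambda>n. poly (p0 n)) f sequentially"
    using uniform_polynomial_approximation by blast
  hence ex: "\<exists>p. uniform_limit (real_spectrum P) (\<lambda>n. poly (p n)) f sequentially"
    using uniform_limit_on_subset[OF _ sub] by blast
  show b: "bounded_clinear (cont_fun_calc f P)" by (rule cont_fun_calc_limit(1)[OF sa ex])
  show on: "(\<lambda>n. onorm (\<lambda>x. poly_operator (p n) P x - cont_fun_calc f P x)) \<longlonglongrightarrow> 0"
    if "onorm P \<le> M" "uniform_limit {0..M} (\<lambda>n. poly (p n)) f sequentially" for M p
    by (rule cont_fun_calc_limit(2)[OF sa ex uniform_limit_on_subset[OF that(2)]])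
      (use sub that(1) in auto)
  show "(\<lambda>n. poly_operator (p n) P x) \<longlonglongrightarrow> cont_fun_calc f P x"
    if "onorm P \<le> M" "uniform_limit {0..M} (\<lambda>n. poly (p n)) f sequentially"
  proof (rule LIM_zero_cancel, rule Lim_null_comparison)
    from tendsto_mult_right[OF on[OF that], of "norm x"]
    show "(\<lambda>n. onorm (\<lambda>x. poly_operator (p n) P x - cont_fun_calc f P x) * norm x) \<longlonglongrightarrow> 0" by simp
    show "\<forall>\<^sub>F n in sequentially. norm (poly_operator (p n) P x - cont_fun_calc f P x)
        \<le> onorm (\<lambda>x. poly_operator (p n) P x - cont_fun_calc f P x) * norm x"
      by (intro always_eventually allI onorm bounded_clinear_imp_bounded_linear
          bounded_clinear_sum_ops bounded_clinear_poly_operator bP b)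
  qed
qed

lemma uniform_polynomial_approximation_nonneg:
  fixes f :: "real \<Rightarrow> real"
  assumes "continuous_on {0..} f"
  shows "\<exists>p. uniform_limit {0..M} (\<lambda>n. poly (p n)) f sequentially"
  by (intro uniform_polynomial_approximation continuous_on_subset[OF assms]) auto

lemma cont_fun_calc_poly:
  assumes "positive_operator P"
  shows "cont_fun_calc (poly p) P x = poly_operator p P x"
proof -
  have "uniform_limit {0..onorm P} (\<lambda>n. poly p) (poly p) sequentially" by (rule uniform_limit_const)
  from cont_fun_calc_tendsto[OF assms _ order_refl this, of x]
  have "(\<lambda>n::nat. poly_operator p P x) \<longlonglongrightarrow> cont_fun_calc (poly p) P x"
    by (simp add: continuous_intros)
  thus ?thesis by (simp add: LIMSEQ_const_iff)
qed

lemma cont_fun_calc_cong: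
  assumes P: "positive_operator P" and "\<And>t. 0 \<le> t \<Longrightarrow> f t = g t"
  shows "cont_fun_calc f P = cont_fun_calc g P"
proof -
  have "uniform_limit {t. complex_of_real t \<in> spectrum P} (\<lambda>n t. poly (p n) t) f sequentially \<longleftrightarrow>
      uniform_limit {t. complex_of_real t \<in> spectrum P} (\<lambda>n t. poly (p n) t) g sequentially" for p
    using real_spectrum_positive_operator(1)[OF P] assms(2)
    by (intro uniform_limit_cong') (auto simp: real_spectrum_def)
  thus ?thesis unfolding cont_fun_calc_def by simp
qed

lemma cont_fun_calc_add:
  assumes P: "positive_operator P" and f: "continuous_on {0..} f" and g: "continuous_on {0..} g"
  shows "cont_fun_calc (\<lambda>t. f t + g t) P x = cont_fun_calc f P x + cont_fun_calc g P x"
proof -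
  obtain p where p: "uniform_limit {0..onorm P} (\<lambda>n. poly (p n)) f sequentially"
    using uniform_polynomial_approximation_nonneg[OF f] by blast
  obtain q where q: "uniform_limit {0..onorm P} (\<lambda>n. poly (q n)) g sequentially"
    using uniform_polynomial_approximation_nonneg[OF g] by blast
  have "uniform_limit {0..onorm P} (\<lambda>n. poly (p n + q n)) (\<lambda>t. f t + g t) sequentially"
    using uniform_limit_add[OF p q] by (simp add: poly_add[abs_def])
  from cont_fun_calc_tendsto[OF P _ order_refl this, of x]
  have "(\<lambda>n. poly_operator (p n) P x + poly_operator (q n) P x)
      \<longlonglongrightarrow> cont_fun_calc (\<lambda>t. f t + g t) P x"
    using f g by (simp add: poly_operator_add continuous_intros)
  moreover have "(\<lambda>n. poly_operator (p n) P x + poly_operator (q n) P x)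
      \<longlonglongrightarrow> cont_fun_calc f P x + cont_fun_calc g P x"
    by (intro tendsto_add cont_fun_calc_tendsto[OF P f order_refl p]
        cont_fun_calc_tendsto[OF P g order_refl q])
  ultimately show ?thesis by (rule LIMSEQ_unique)
qed

lemma cont_fun_calc_mult:
  assumes P: "positive_operator P" and f: "continuous_on {0..} f" and g: "continuous_on {0..} g"
  shows "cont_fun_calc (\<lambda>t. f t * g t) P x = cont_fun_calc f P (cont_fun_calc g P x)"
proof -
  note bP = positive_operator_bounded_clinear[OF P]
  note bf = bounded_clinear_cont_fun_calc[OF P f]
  obtain p where p: "uniform_limit {0..onorm P} (\<lambda>n. poly (p n)) f sequentially"
    using uniform_polynomial_approximation_nonneg[OF f] by blast
  obtain q where q: "uniform_limit {0..onorm P} (\<lambda>n. poly (q n)) g sequentially"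
    using uniform_polynomial_approximation_nonneg[OF g] by blast
  have "bounded (f ` {0..onorm P})" "bounded (g ` {0..onorm P})"
    by (intro compact_imp_bounded compact_continuous_image
        continuous_on_subset[OF f] continuous_on_subset[OF g] compact_Icc; auto)+
  from uniform_lim_mult[OF p q this]
  have "uniform_limit {0..onorm P} (\<lambda>n. poly (p n * q n)) (\<lambda>t. f t * g t) sequentially"
    by (simp add: poly_mult[abs_def])
  from cont_fun_calc_tendsto[OF P _ order_refl this, of x]
  have "(\<lambda>n. poly_operator (p n) P (poly_operator (q n) P x))
      \<longlonglongrightarrow> cont_fun_calc (\<lambda>t. f t * g t) P x"
    using f g by (simp add: poly_operator_mult[OF bP] continuous_intros)
  moreover have "(\<lambda>n. poly_operator (p n) P (poly_operator (q n) P x))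
      \<longlonglongrightarrow> cont_fun_calc f P (cont_fun_calc g P x)"
  proof -
    note qx = cont_fun_calc_tendsto[OF P g order_refl q, of x]
    have "(\<lambda>n. poly_operator (p n) P (poly_operator (q n) P x)
        - cont_fun_calc f P (poly_operator (q n) P x)) \<longlonglongrightarrow> 0"
    proof (rule Lim_null_comparison)
      show "(\<lambda>n. onorm (\<lambda>x. poly_operator (p n) P x - cont_fun_calc f P x)
          * norm (poly_operator (q n) P x)) \<longlonglongrightarrow> 0"
        using tendsto_mult[OF cont_fun_calc_onorm_tendsto[OF P f order_refl p] tendsto_norm[OF qx]]
        by simp
      show "\<forall>\<^sub>F n in sequentially. norm (poly_operator (p n) P (poly_operator (q n) P x)
          - cont_fun_calc f P (poly_operator (q n) P x))
        \<le> onorm (\<lambda>x. poly_operator (p n) P x - cont_fun_calc f P x)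
          * norm (poly_operator (q n) P x)"
      proof (intro always_eventually allI)
        fix n
        have "bounded_linear (\<lambda>x. poly_operator (p n) P x - cont_fun_calc f P x)"
          by (intro bounded_clinear_imp_bounded_linear bounded_clinear_sum_ops
              bounded_clinear_poly_operator bP bf)
        from onorm[OF this, of "poly_operator (q n) P x"]
        show "norm (poly_operator (p n) P (poly_operator (q n) P x)
          - cont_fun_calc f P (poly_operator (q n) P x))
        \<le> onorm (\<lambda>x. poly_operator (p n) P x - cont_fun_calc f P x)
          * norm (poly_operator (q n) P x)" .
      qed
    qed
    from tendsto_add[OF this bounded_linear.tendsto[OF bounded_clinear_imp_bounded_linear[OF bf] qx]]
    show ?thesis by simp
  qed
  ultimately show ?thesis by (rule LIMSEQ_unique)
qed

lemma cont_fun_calc_const: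
  assumes "positive_operator P"
  shows "cont_fun_calc (\<lambda>t. a) P x = a *\<^sub>R x"
proof -
  have "poly [:a:] = (\<lambda>t. a)" by (simp add: fun_eq_iff)
  thus ?thesis using cont_fun_calc_poly[OF assms, of "[:a:]" x] by (simp add: poly_operator_def)
qed

lemma cont_fun_calc_ident:
  assumes "positive_operator P"
  shows "cont_fun_calc (\<lambda>t. t) P x = P x"
proof -
  have "poly [:0, 1:] = (\<lambda>t::real. t)" by (simp add: fun_eq_iff)
  thus ?thesis
    using cont_fun_calc_poly[OF assms, of "[:0, 1:]" x] positive_operator_bounded_clinear[OF assms]
    by (simp add: poly_operator_pCons bounded_clinear_zero)
qed

lemma selfadjoint_cont_fun_calc:
  assumes P: "positive_operator P" and f: "continuous_on {0..} f"
  shows "selfadjoint (cont_fun_calc f P)"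
proof -
  obtain p where p: "uniform_limit {0..onorm P} (\<lambda>n. poly (p n)) f sequentially"
    using uniform_polynomial_approximation_nonneg[OF f] by blast
  note lim = cont_fun_calc_tendsto[OF P f order_refl p]
  note sa = selfadjoint_poly_operator[OF positive_operator_selfadjoint[OF P]]
  have bl: "bounded_linear (\<lambda>x. cinner x (y::'a))" for y
    by (rule bounded_linear_intro[where K = "norm y"])
      (simp_all add: cinner_add_left cinner_scaleR_left cinner_Cauchy_Schwarz scaleR_conv_of_real)
  have "cinner (cont_fun_calc f P x) y = cinner x (cont_fun_calc f P y)" for x y
  proof -
    have "(\<lambda>n. cinner (poly_operator (p n) P x) y) \<longlonglongrightarrow> cinner (cont_fun_calc f P x) y"
      by (rule bounded_linear.tendsto[OF bl lim])
    moreover have "(\<lambda>n. cnj (cinner (poly_operator (p n) P y) x)) \<longlonglongrightarrow>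
        cnj (cinner (cont_fun_calc f P y) x)"
      by (intro tendsto_cnj bounded_linear.tendsto[OF bl lim])
    hence "(\<lambda>n. cinner (poly_operator (p n) P x) y) \<longlonglongrightarrow> cinner x (cont_fun_calc f P y)"
      by (simp only: selfadjointD(2)[OF sa] cinner_commute[of x "cont_fun_calc f P y"]
          cinner_commute[of x "poly_operator _ P y"])
    ultimately show ?thesis by (rule LIMSEQ_unique)
  qed
  thus ?thesis using bounded_clinear_cont_fun_calc[OF P f]
    by (simp add: selfadjoint_def adjoint_pair_def)
qed

lemma power2_norm_cont_fun_calc:
  assumes P: "positive_operator P" and f: "continuous_on {0..} f"
  shows "(norm (cont_fun_calc f P x))\<^sup>2 = Re (cinner (cont_fun_calc (\<lambda>t. (f t)\<^sup>2) P x) x)"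
  by (simp add: power2_eq_square[of "f _"] cont_fun_calc_mult[OF P f f] power2_norm_eq_Re_cinner
      selfadjointD(2)[OF selfadjoint_cont_fun_calc[OF P f], of "cont_fun_calc f P x" x])

text \<open>Positivity comes from \<open>f = (\<surd>f)\<^sup>2\<close>, which gives \<open>\<langle>f(P) x, x\<rangle> = \<parallel>(\<surd>f)(P) x\<parallel>\<^sup>2\<close>.\<close>

lemma positive_operator_cont_fun_calc:
  assumes P: "positive_operator P" and f: "continuous_on {0..} f"
    and nn: "\<And>t. 0 \<le> t \<Longrightarrow> 0 \<le> f t"
  shows "positive_operator (cont_fun_calc f P)"
proof -
  have "cont_fun_calc f P = cont_fun_calc (\<lambda>t. (sqrt (f t))\<^sup>2) P"
    by (rule cont_fun_calc_cong[OF P]) (simp add: nn)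
  moreover have "continuous_on {0..} (\<lambda>t. sqrt (f t))" by (intro continuous_intros f)
  ultimately have "0 \<le> Re (cinner (cont_fun_calc f P x) x)" for x
    using power2_norm_cont_fun_calc[OF P, of "\<lambda>t. sqrt (f t)" x] by (metis zero_le_power2)
  thus ?thesis using selfadjoint_cont_fun_calc[OF P f] by (simp add: positive_operator_def)
qed

lemma cont_fun_calc_mono:
  assumes P: "positive_operator P" and f: "continuous_on {0..} f" and g: "continuous_on {0..} g"
    and le: "\<And>t. 0 \<le> t \<Longrightarrow> f t \<le> g t"
  shows "Re (cinner (cont_fun_calc f P x) x) \<le> Re (cinner (cont_fun_calc g P x) x)"
proof -
  have d: "continuous_on {0..} (\<lambda>t. g t - f t)" by (intro continuous_intros f g)
  have "cont_fun_calc g P x = cont_fun_calc f P x + cont_fun_calc (\<lambda>t. g t - f t) P x"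
    using cont_fun_calc_add[OF P f d, of x] by simp
  moreover have "0 \<le> Re (cinner (cont_fun_calc (\<lambda>t. g t - f t) P x) x)"
    using positive_operator_cont_fun_calc[OF P d] le by (simp add: positive_operator_def)
  ultimately show ?thesis by (simp add: cinner_add_left)
qed

lemma poly_operator_pcompose_square:
  assumes "bounded_clinear T"
  shows "poly_operator (pcompose p [:0, 0, 1:]) T x = poly_operator p (\<lambda>x. T (T x)) x"
proof (induction p arbitrary: x)
  case (pCons a p)
  have "bounded_clinear (\<lambda>x. T (T x))" by (rule bounded_clinear_compose[OF assms assms])
  thus ?case
    using pCons.IH
    by (simp add: pcompose_pCons poly_operator_add poly_operator_pCons[OF assms]
        poly_operator_pCons poly_operator_mult[OF assms] bounded_clinear_zero[OF assms]
        del: mult_pCons_left)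
qed simp

text \<open>Polynomials close to \<open>u \<mapsto> f (\<surd>u)\<close>, evaluated at \<open>t\<^sup>2\<close>, are even polynomials close to \<open>f\<close>, and
  for polynomials in \<open>P\<^sup>2\<close> and \<open>Q\<^sup>2\<close> the claim is algebraic.  With \<open>P = \<bar>A\<bar>\<close> and \<open>Q = \<bar>A\<^sup>*\<bar>\<close> the
  hypothesis reads \<open>A A\<^sup>* A = A A\<^sup>* A\<close>.\<close>

lemma cont_fun_calc_intertwine:
  assumes A: "bounded_clinear A" and P: "positive_operator P" and Q: "positive_operator Q"
    and AP: "\<And>x. A (P (P x)) = Q (Q (A x))" and f: "continuous_on {0..} f"
  shows "A (cont_fun_calc f P x) = cont_fun_calc f Q (A x)"
proof -
  note bP = positive_operator_bounded_clinear[OF P] and bQ = positive_operator_bounded_clinear[OF Q]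
  define M where "M = max (onorm P) (onorm Q)"
  have M0: "0 \<le> M" using bounded_clinear_onorm_nonneg[OF bP] by (simp add: M_def)
  have "continuous_on {0..} (\<lambda>u. f (sqrt u))"
    by (rule continuous_on_compose2[OF f]) (auto intro!: continuous_intros)
  then obtain p where p: "uniform_limit {0..M\<^sup>2} (\<lambda>n. poly (p n)) (\<lambda>u. f (sqrt u)) sequentially"
    using uniform_polynomial_approximation_nonneg by blast
  define q where "q = (\<lambda>n. pcompose (p n) [:0, 0, 1:])"
  have q: "uniform_limit {0..M} (\<lambda>n. poly (q n)) f sequentially"
  proof (rule uniform_limitI)
    fix e :: real assume "e > 0"
    from uniform_limitD[OF p this]
    show "\<forall>\<^sub>F n in sequentially. \<forall>t\<in>{0..M}. dist (poly (q n) t) (f t) < e"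
    proof eventually_elim
      case (elim n)
      show ?case
      proof
        fix t assume t: "t \<in> {0..M}"
        hence "t\<^sup>2 \<in> {0..M\<^sup>2}" by (simp add: power_mono)
        with elim have "dist (poly (p n) (t\<^sup>2)) (f (sqrt (t\<^sup>2))) < e" by blast
        thus "dist (poly (q n) t) (f t) < e"
          using t by (simp add: q_def poly_pcompose power2_eq_square)
      qed
    qed
  qed
  have "(\<lambda>n. A (poly_operator (q n) P x)) \<longlonglongrightarrow> A (cont_fun_calc f P x)"
    by (rule bounded_linear.tendsto[OF bounded_clinear_imp_bounded_linear[OF A]
          cont_fun_calc_tendsto[OF P f _ q]]) (simp add: M_def)
  moreover have "A (poly_operator (q n) P x) = poly_operator (q n) Q (A x)" for n
    unfolding q_def poly_operator_pcompose_square[OF bP] poly_operator_pcompose_square[OF bQ]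
    by (rule poly_operator_intertwine[OF A bounded_clinear_compose[OF bQ bQ]
          bounded_clinear_compose[OF bP bP] AP])
  moreover have "(\<lambda>n. poly_operator (q n) Q (A x)) \<longlonglongrightarrow> cont_fun_calc f Q (A x)"
    by (rule cont_fun_calc_tendsto[OF Q f _ q]) (simp add: M_def)
  ultimately show ?thesis using LIMSEQ_unique by auto
qed

section \<open>Powers and the absolute value\<close>

text \<open>Constant 1 at \<open>s = 0\<close>, also at \<open>t = 0\<close>, so that \<open>P\<^sup>0 = I\<close> for every positive \<open>P\<close>.\<close>

definition power_fun :: "real \<Rightarrow> real \<Rightarrow> real" where
  "power_fun s t = (if s = 0 then 1 else t powr s)"

lemma op_powr_conv: "P powr\<^sub>o\<^sub>p s = cont_fun_calc (power_fun s) P"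
  by (simp add: op_powr_def power_fun_def[abs_def])

lemma power_fun_nonneg: "0 \<le> power_fun s t"
  by (simp add: power_fun_def)

lemma continuous_on_power_fun: "0 \<le> s \<Longrightarrow> continuous_on {0..} (power_fun s)"
  unfolding power_fun_def[abs_def]
  by (cases "s = 0") (auto intro!: continuous_on_powr' continuous_on_id continuous_on_const)

lemma power_fun_square: "0 \<le> t \<Longrightarrow> (power_fun s t)\<^sup>2 = power_fun (2 * s) t"
  by (cases "t = 0") (auto simp: power_fun_def power2_eq_square powr_add[symmetric])

lemma power_fun_powr: "1 \<le> r \<Longrightarrow> power_fun (s * r) t = power_fun s t powr r"
  by (simp add: power_fun_def powr_powr)

lemma positive_op_powr:
  assumes "positive_operator P" "0 \<le> s"
  shows "positive_operator (P powr\<^sub>o\<^sub>p s)"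
  unfolding op_powr_conv
  by (intro positive_operator_cont_fun_calc assms continuous_on_power_fun power_fun_nonneg)

lemma op_powr_op_powr_same:
  assumes "positive_operator P" "0 \<le> s"
  shows "(P powr\<^sub>o\<^sub>p s) ((P powr\<^sub>o\<^sub>p s) x) = (P powr\<^sub>o\<^sub>p (2 * s)) x"
proof -
  have "cont_fun_calc (power_fun (2 * s)) P = cont_fun_calc (\<lambda>t. power_fun s t * power_fun s t) P"
    by (rule cont_fun_calc_cong[OF assms(1)]) (simp add: power_fun_square[symmetric] power2_eq_square)
  thus ?thesis
    by (simp add: op_powr_conv cont_fun_calc_mult[OF assms(1) continuous_on_power_fun
          continuous_on_power_fun] assms(2))
qed

lemma
  assumes A: "bounded_clinear A"
  shows positive_op_abs: "positive_operator (op_abs A)"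
    and op_abs_op_abs: "op_abs A (op_abs A x) = cadjoint A (A x)"
proof -
  let ?P = "cadjoint A \<circ> A"
  note bA' = bounded_clinear_cadjoint[OF A]
  note adj = adjoint_pairD[OF adjoint_pair_cadjoint[OF A]]
    adjoint_pairD[OF adjoint_pair_sym[OF adjoint_pair_cadjoint[OF A]]]
  have P: "positive_operator ?P"
    using bounded_clinear_compose[OF bA' A]
    by (simp add: positive_operator_def selfadjoint_def adjoint_pair_def o_def adj cinner_self
        flip: of_real_power)
  show "positive_operator (op_abs A)"
    unfolding op_abs_def by (rule positive_op_powr[OF P]) simp
  have "op_abs A (op_abs A x) = cont_fun_calc (power_fun 1) ?P x"
    using op_powr_op_powr_same[OF P, of "1/2" x] by (simp add: op_abs_def op_powr_conv)
  also have "\<dots> = cont_fun_calc (\<lambda>t. t) ?P x"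
    by (subst cont_fun_calc_cong[OF P, of "power_fun 1" "\<lambda>t. t"]) (simp_all add: power_fun_def)
  finally show "op_abs A (op_abs A x) = cadjoint A (A x)" by (simp add: cont_fun_calc_ident[OF P])
qed

section \<open>The mixed Schwarz and Hoelder-McCarthy inequalities\<close>

text \<open>Let \<open>P\<close>, \<open>Q\<close> be the absolute values of \<open>A\<close>, \<open>A\<^sup>*\<close>, and for \<open>\<epsilon> > 0\<close> let \<open>h(t)\<^sup>2 = t\<^bsup>2\<theta>\<^esup> + \<epsilon>\<close>, so that
  \<open>h(P)\<close> is invertible.  Since \<open>A (1/h)(P) = (1/h)(Q) A\<close>,
  \<open>\<langle>A x, y\<rangle> = \<langle>h(P) x, A\<^sup>* (1/h)(Q) y\<rangle>\<close>.  Here \<open>\<parallel>h(P) x\<parallel>\<^sup>2 = \<langle>P\<^bsup>2\<theta>\<^esup> x, x\<rangle> + \<epsilon> \<parallel>x\<parallel>\<^sup>2\<close> and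
  \<open>\<parallel>A\<^sup>* (1/h)(Q) y\<parallel>\<^sup>2 = \<langle>(t\<^sup>2/h\<^sup>2)(Q) y, y\<rangle>\<close>, where \<open>t\<^sup>2/h(t)\<^sup>2 \<le> t\<^bsup>2(1-\<theta>)\<^esup>\<close>.  Letting \<open>\<epsilon>\<close> tend to 0
  finishes the proof; the polar decomposition of \<open>A\<close> is avoided.\<close>

lemma mixed_Schwarz_inequality:
  assumes A: "bounded_clinear A" and \<theta>: "0 \<le> \<theta>" "\<theta> \<le> 1"
  shows "(cmod (cinner (A x) y))\<^sup>2 \<le> Re (cinner ((op_abs A powr\<^sub>o\<^sub>p (2 * \<theta>)) x) x)
      * Re (cinner ((op_abs (cadjoint A) powr\<^sub>o\<^sub>p (2 * (1 - \<theta>))) y) y)"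
proof -
  define A' where "A' = cadjoint A"
  have A': "bounded_clinear A'" "adjoint_pair A A'"
    using bounded_clinear_cadjoint[OF A] adjoint_pair_cadjoint[OF A] by (simp_all add: A'_def)
  define P Q where "P = op_abs A" and "Q = op_abs A'"
  have P: "positive_operator P" and PP: "\<And>x. P (P x) = A' (A x)"
    using positive_op_abs[OF A] op_abs_op_abs[OF A] by (simp_all add: P_def A'_def)
  have Q: "positive_operator Q" and QQ: "\<And>x. Q (Q x) = A (A' x)"
    using positive_op_abs[OF A'(1)] op_abs_op_abs[OF A'(1)] cadjoint_cadjoint[OF A]
    by (simp_all add: Q_def A'_def)
  define a where "a = Re (cinner ((P powr\<^sub>o\<^sub>p (2 * \<theta>)) x) x)"
  define b where "b = Re (cinner ((Q powr\<^sub>o\<^sub>p (2 * (1 - \<theta>))) y) y)"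
  have b0: "0 \<le> b"
    using positive_op_powr[OF Q, of "2 * (1 - \<theta>)"] \<theta> by (simp add: positive_operator_def b_def)
  have cont1: "continuous_on {0..} (power_fun (2 * \<theta>))"
    and cont2: "continuous_on {0..} (power_fun (2 * (1 - \<theta>)))"
    using \<theta> by (auto intro: continuous_on_power_fun)
  have eps: "(cmod (cinner (A x) y))\<^sup>2 \<le> (a + \<epsilon> * (norm x)\<^sup>2) * b" if \<epsilon>: "\<epsilon> > 0" for \<epsilon>
  proof -
    define h where "h = (\<lambda>t. sqrt (power_fun (2 * \<theta>) t + \<epsilon>))"
    define g where "g = (\<lambda>t. 1 / h t)"
    have arg: "power_fun (2 * \<theta>) t + \<epsilon> > 0" for t
      using power_fun_nonneg[of "2 * \<theta>" t] \<epsilon> by linarith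
    have hpos: "h t > 0" for t using arg by (simp add: h_def)
    have h2: "(h t)\<^sup>2 = power_fun (2 * \<theta>) t + \<epsilon>" for t using arg[of t] by (simp add: h_def)
    have ch: "continuous_on {0..} h" unfolding h_def by (intro continuous_intros cont1)
    have hne: "\<forall>t\<in>{0..}. h t \<noteq> 0" using hpos by (metis less_irrefl)
    have cg: "continuous_on {0..} g"
      unfolding g_def by (intro continuous_intros ch hne)
    have "cont_fun_calc (\<lambda>t. g t * h t) P = cont_fun_calc (\<lambda>t. 1) P"
      by (rule cont_fun_calc_cong[OF P]) (use hpos in \<open>simp add: g_def less_imp_neq[symmetric]\<close>)
    hence "x = cont_fun_calc g P (cont_fun_calc h P x)"
      by (metis cont_fun_calc_mult[OF P cg ch] cont_fun_calc_const[OF P] scaleR_one)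
    hence "A x = cont_fun_calc g Q (A (cont_fun_calc h P x))"
      using cont_fun_calc_intertwine[OF A P Q _ cg] PP QQ by metis
    hence "cinner (A x) y = cinner (cont_fun_calc h P x) (A' (cont_fun_calc g Q y))"
      using selfadjointD(2)[OF selfadjoint_cont_fun_calc[OF Q cg]] adjoint_pairD[OF A'(2)] by metis
    hence "cmod (cinner (A x) y) \<le> norm (cont_fun_calc h P x) * norm (A' (cont_fun_calc g Q y))"
      by (simp add: cinner_Cauchy_Schwarz)
    hence "(cmod (cinner (A x) y))\<^sup>2
        \<le> (norm (cont_fun_calc h P x))\<^sup>2 * (norm (A' (cont_fun_calc g Q y)))\<^sup>2"
      by (metis norm_ge_zero power_mono power_mult_distrib)
    also have h_norm: "(norm (cont_fun_calc h P x))\<^sup>2 = a + \<epsilon> * (norm x)\<^sup>2"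
    proof -
      have "cont_fun_calc (\<lambda>t. (h t)\<^sup>2) P x = (P powr\<^sub>o\<^sub>p (2 * \<theta>)) x + \<epsilon> *\<^sub>R x"
        by (simp add: h2 op_powr_conv cont_fun_calc_add[OF P cont1] cont_fun_calc_const[OF P])
      thus ?thesis
        unfolding power2_norm_cont_fun_calc[OF P ch] by (simp add: a_def cinner_simps cinner_self)
    qed
    also have "\<dots> * (norm (A' (cont_fun_calc g Q y)))\<^sup>2 \<le> \<dots> * b"
    proof (rule mult_left_mono)
      let ?v = "cont_fun_calc g Q y"
      have ctg: "continuous_on {0..} (\<lambda>t. t * g t)" by (intro continuous_intros cg)
      have "cinner (A' ?v) (A' ?v) = cinner (Q ?v) (Q ?v)"
        using adjoint_pairD[OF A'(2), of "A' ?v" ?v]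
          selfadjointD(2)[OF positive_operator_selfadjoint[OF Q], of "Q ?v" ?v] QQ[of ?v] by simp
      hence "(norm (A' ?v))\<^sup>2 = (norm (Q ?v))\<^sup>2" by (simp add: power2_norm_eq_Re_cinner)
      also have "Q ?v = cont_fun_calc (\<lambda>t. t * g t) Q y"
        by (simp add: cont_fun_calc_mult[OF Q continuous_on_id cg] cont_fun_calc_ident[OF Q])
      also have "(norm \<dots>)\<^sup>2 = Re (cinner (cont_fun_calc (\<lambda>t. (t * g t)\<^sup>2) Q y) y)"
        by (rule power2_norm_cont_fun_calc[OF Q ctg])
      also have "\<dots> \<le> b" unfolding b_def op_powr_conv
      proof (rule cont_fun_calc_mono[OF Q _ cont2])
        show "continuous_on {0..} (\<lambda>t. (t * g t)\<^sup>2)" by (intro continuous_intros ctg)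
        fix t :: real assume t: "0 \<le> t"
        have "t\<^sup>2 \<le> power_fun (2 * (1 - \<theta>)) t * (power_fun (2 * \<theta>) t + \<epsilon>)"
        proof (cases "t = 0")
          case False
          hence "t\<^sup>2 = power_fun (2 * (1 - \<theta>)) t * power_fun (2 * \<theta>) t"
            using t by (auto simp: power_fun_def powr_add[symmetric] powr_numeral)
          also have "\<dots> \<le> power_fun (2 * (1 - \<theta>)) t * (power_fun (2 * \<theta>) t + \<epsilon>)"
            using \<epsilon> by (intro mult_left_mono power_fun_nonneg) simp
          finally show ?thesis .
        qed (use \<epsilon> in \<open>auto intro!: mult_nonneg_nonneg add_nonneg_nonneg simp: power_fun_nonneg\<close>)
        thus "(t * g t)\<^sup>2 \<le> power_fun (2 * (1 - \<theta>)) t"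
          using arg[of t] by (simp add: g_def power_mult_distrib power_divide h2 divide_le_eq)
      qed
      finally show "(norm (A' ?v))\<^sup>2 \<le> b" .
      show "0 \<le> a + \<epsilon> * (norm x)\<^sup>2" by (simp flip: h_norm)
    qed
    finally show ?thesis .
  qed
  have "(cmod (cinner (A x) y))\<^sup>2 \<le> a * b"
  proof (rule field_le_epsilon)
    fix e :: real assume e: "e > 0"
    define k where "k = (norm x)\<^sup>2 * b"
    have k: "k \<ge> 0" using b0 by (simp add: k_def)
    have "(cmod (cinner (A x) y))\<^sup>2 \<le> (a + e / (k + 1) * (norm x)\<^sup>2) * b"
      by (rule eps) (use e k in simp)
    also have "\<dots> = a * b + e * (k / (k + 1))" by (simp add: k_def algebra_simps)
    also have "\<dots> \<le> a * b + e * 1" using e k by (intro add_left_mono mult_left_mono) auto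
    finally show "(cmod (cinner (A x) y))\<^sup>2 \<le> a * b + e" by simp
  qed
  thus ?thesis by (simp add: a_def b_def P_def Q_def A'_def)
qed

text \<open>Young's inequality for \<open>u\<close> and \<open>c\<^bsup>r-1\<^esup>\<close> with the exponents \<open>r\<close> and \<open>r/(r-1)\<close>; it says that
  \<open>u\<^bsup>r\<^esup>\<close> lies above its tangent at \<open>c\<close>.\<close>

lemma powr_tangent_inequality:
  fixes u c r :: real
  assumes "0 \<le> u" "0 \<le> c" "1 \<le> r"
  shows "r * c powr (r - 1) * u \<le> u powr r + (r - 1) * c powr r"
proof (cases "r = 1")
  case True
  thus ?thesis using assms by (cases "c = 0") auto
next
  case False
  hence r: "r > 1" using assms by simp
  have "u * c powr (r - 1) \<le> u powr r / r + (c powr (r - 1)) powr (r / (r - 1)) / (r / (r - 1))"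
    by (rule Youngs_inequality) (use r assms in \<open>auto simp: field_simps\<close>)
  also have "(c powr (r - 1)) powr (r / (r - 1)) = c powr r" using r by (simp add: powr_powr)
  finally have "r * (u * c powr (r - 1)) \<le> r * (u powr r / r + c powr r / (r / (r - 1)))"
    using r by (intro mult_left_mono) auto
  also have "\<dots> = u powr r + (r - 1) * c powr r" using r by (simp add: field_simps)
  finally show ?thesis by (simp add: mult_ac)
qed

text \<open>As in Jensen's inequality, apply monotonicity of the functional calculus to the tangent of
  \<open>u \<mapsto> u\<^bsup>r\<^esup>\<close> at the mean \<open>c = \<langle>P\<^bsup>s\<^esup> x, x\<rangle>\<close>, with \<open>u = t\<^bsup>s\<^esup>\<close>; at the mean the linear term drops out.\<close>

lemma Holder_McCarthy_inequality:
  assumes P: "positive_operator P" and s: "0 \<le> s" and r: "1 \<le> r" and x: "norm x = 1"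
  shows "Re (cinner ((P powr\<^sub>o\<^sub>p s) x) x) powr r \<le> Re (cinner ((P powr\<^sub>o\<^sub>p (s * r)) x) x)"
proof -
  define c where "c = Re (cinner ((P powr\<^sub>o\<^sub>p s) x) x)"
  have c: "c \<ge> 0" using positive_op_powr[OF P s] by (simp add: positive_operator_def c_def)
  define k where "k = r * c powr (r - 1)"
  define d where "d = (r - 1) * c powr r"
  have cs: "continuous_on {0..} (power_fun s)" "continuous_on {0..} (power_fun (s * r))"
    using s r by (auto intro!: continuous_on_power_fun)
  have "Re (cinner (cont_fun_calc (\<lambda>t. k * power_fun s t) P x) x)
      \<le> Re (cinner (cont_fun_calc (\<lambda>t. power_fun (s * r) t + d) P x) x)"
  proof (rule cont_fun_calc_mono[OF P])
    show "k * power_fun s t \<le> power_fun (s * r) t + d" for t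
      using powr_tangent_inequality[OF power_fun_nonneg c r, of s t]
      by (simp add: k_def d_def power_fun_powr[OF r])
  qed (intro continuous_intros cs)+
  moreover have "cont_fun_calc (\<lambda>t. k * power_fun s t) P x = k *\<^sub>R (P powr\<^sub>o\<^sub>p s) x"
    by (simp add: cont_fun_calc_mult[OF P continuous_on_const cs(1)] cont_fun_calc_const[OF P]
        op_powr_conv)
  moreover have "cont_fun_calc (\<lambda>t. power_fun (s * r) t + d) P x = (P powr\<^sub>o\<^sub>p (s * r)) x + d *\<^sub>R x"
    by (simp add: cont_fun_calc_add[OF P cs(2) continuous_on_const] cont_fun_calc_const[OF P]
        op_powr_conv)
  ultimately have "k * c \<le> Re (cinner ((P powr\<^sub>o\<^sub>p (s * r)) x) x) + d"
    using x by (simp add: cinner_simps c_def cinner_self)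
  moreover have "k * c = r * c powr r" using c by (cases "c = 0") (auto simp: k_def powr_diff)
  ultimately show ?thesis by (simp add: d_def c_def algebra_simps)
qed

section \<open>Normal products\<close>

lemma power_le_const_mult_power_imp_le:
  fixes a s C :: real
  assumes "0 \<le> a" "0 \<le> s" and le: "\<And>n. a ^ Suc n \<le> C * s ^ n"
  shows "a \<le> s"
proof (rule ccontr)
  assume "\<not> a \<le> s"
  hence as: "s < a" by simp
  hence a0: "a > 0" using assms by simp
  have "(\<lambda>n. C * (s / a) ^ n) \<longlonglongrightarrow> C * 0"
    by (intro tendsto_mult tendsto_const LIMSEQ_power_zero) (use assms as a0 in simp)
  moreover have "a \<le> C * (s / a) ^ n" for n
    using le[of n] a0 by (simp add: power_divide field_simps)
  ultimately have "a \<le> C * 0" by (intro LIMSEQ_le_const) auto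
  thus False using a0 by simp
qed

text \<open>Normality gives \<open>\<parallel>T\<^sup>* y\<parallel> = \<parallel>T y\<parallel>\<close>, hence
  \<open>\<parallel>T y\<parallel>\<^sup>2 = \<langle>T\<^sup>* T y, y\<rangle> \<le> \<parallel>T\<^sup>2 y\<parallel> \<parallel>y\<parallel>\<close>: the norms \<open>\<parallel>T\<^bsup>n\<^esup> x\<parallel>\<close> are log-convex in \<open>n\<close>.\<close>

lemma normal_operator_norm_power:
  assumes T: "bounded_clinear T" and N: "normal_operator T" and x: "norm x = 1"
  shows "norm (T x) ^ n \<le> norm ((T ^^ n) x)"
proof -
  define S where "S = cadjoint T"
  have S: "adjoint_pair T S" using adjoint_pair_cadjoint[OF T] by (simp add: S_def)
  have comm: "S (T y) = T (S y)" for y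
    using N by (simp add: normal_operator_def S_def fun_eq_iff)
  have norm_eq: "norm (S y) = norm (T y)" for y
  proof -
    have "cinner (S y) (S y) = cinner (T y) (T y)"
      using adjoint_pairD[OF S] adjoint_pairD[OF adjoint_pair_sym[OF S]] comm by metis
    hence "(norm (S y))\<^sup>2 = (norm (T y))\<^sup>2" by (simp add: power2_norm_eq_Re_cinner)
    thus ?thesis by simp
  qed
  have convex: "(norm (T y))\<^sup>2 \<le> norm (T (T y)) * norm y" for y
  proof -
    have "(norm (T y))\<^sup>2 = cmod (cinner (T y) (T y))" by (simp add: cinner_self norm_power)
    also have "\<dots> = cmod (cinner (S (T y)) y)" by (simp add: adjoint_pairD[OF adjoint_pair_sym[OF S]])
    also have "\<dots> \<le> norm (S (T y)) * norm y" by (rule cinner_Cauchy_Schwarz)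
    finally show ?thesis by (simp add: norm_eq)
  qed
  \<comment> \<open>Log-convexity makes the ratios \<open>\<parallel>T\<^bsup>n+1\<^esup> x\<parallel> / \<parallel>T\<^bsup>n\<^esup> x\<parallel>\<close> nondecreasing.\<close>
  have ratio: "norm (T x) * norm ((T ^^ n) x) \<le> norm ((T ^^ Suc n) x)" for n
  proof (induction n)
    case (Suc n)
    let ?a = "norm ((T ^^ n) x)" and ?b = "norm ((T ^^ Suc n) x)" and ?c = "norm ((T ^^ Suc (Suc n)) x)"
    have conv: "?b\<^sup>2 \<le> ?c * ?a" using convex[of "(T ^^ n) x"] by simp
    show ?case
    proof (cases "?b = 0")
      case False
      hence a: "?a > 0" using bounded_clinear_zero[OF T] by auto
      have "norm (T x) * ?b * ?a = ?b * (norm (T x) * ?a)" by simp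
      also have "\<dots> \<le> ?b * ?b" by (rule mult_left_mono[OF Suc.IH]) simp
      also have "\<dots> \<le> ?c * ?a" using conv by (simp add: power2_eq_square)
      finally show ?thesis using a by (simp only: mult_le_cancel_right_pos)
    qed simp
  qed (simp add: x)
  show ?thesis
  proof (induction n)
    case (Suc n)
    have "norm (T x) ^ Suc n \<le> norm (T x) * norm ((T ^^ n) x)"
      using Suc.IH by (simp add: mult_left_mono)
    also have "\<dots> \<le> norm ((T ^^ Suc n) x)" by (rule ratio)
    finally show ?case .
  qed (simp add: x)
qed

text \<open>The product form \<open>T = R\<^sup>2 Y\<close> with self-adjoint \<open>R\<close>, \<open>Y\<close> gives this bound without the spectral
  radius formula.  Put \<open>S = R Y R\<close>.  The powers
  \<open>T\<^bsup>n+1\<^esup> = R S\<^bsup>n\<^esup> R Y\<close> grow at most like \<open>\<parallel>S\<parallel>\<^bsup>n\<^esup>\<close>, so \<open>\<parallel>T\<parallel> \<le> \<parallel>S\<parallel>\<close> by normality; and \<open>\<parallel>S\<parallel>\<close> or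
  \<open>-\<parallel>S\<parallel>\<close> is in the spectrum of the self-adjoint \<open>S\<close>, hence, if nonzero, in that of \<open>T\<close>.\<close>

lemma norm_normal_product_le_spectral_radius:
  fixes R Y :: "'a::chilbert_space \<Rightarrow> 'a"
  assumes R: "selfadjoint R" and Y: "selfadjoint Y" and N: "normal_operator (\<lambda>x. R (R (Y x)))"
    and x: "norm x = 1"
  shows "norm (R (R (Y x))) \<le> spectral_radius (\<lambda>x. R (R (Y x)))"
proof -
  note bR = selfadjointD(1)[OF R] and bY = selfadjointD(1)[OF Y]
  define T where "T = (\<lambda>x. R (R (Y x)))"
  define S where "S = (\<lambda>x. R (Y (R x)))"
  have bT: "bounded_clinear T"
    unfolding T_def by (rule bounded_clinear_compose[OF bR bounded_clinear_compose[OF bR bY]])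
  have bS: "bounded_clinear S" unfolding S_def
    by (rule bounded_clinear_compose[OF bR bounded_clinear_compose[OF bY bR]])
  have saS: "selfadjoint S"
    using bS by (simp add: selfadjoint_def adjoint_pair_def)
      (simp add: S_def selfadjointD(2)[OF R] selfadjointD(2)[OF Y])
  define s where "s = onorm S"
  have s0: "s \<ge> 0" using bounded_clinear_onorm_nonneg[OF bS] by (simp add: s_def)
  have pow: "norm ((S ^^ n) v) \<le> s ^ n * norm v" for n v
  proof (induction n)
    case (Suc n)
    have "norm ((S ^^ Suc n) v) \<le> s * norm ((S ^^ n) v)"
      using bounded_clinear_norm_le[OF bS] by (simp add: s_def)
    also have "\<dots> \<le> s * (s ^ n * norm v)" using Suc.IH s0 by (rule mult_left_mono)
    finally show ?case by simp
  qed simp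
  have Tpow: "(T ^^ Suc n) v = R ((S ^^ n) (R (Y v)))" for n v
    by (induction n) (simp_all add: T_def S_def)
  have "norm (T x) ^ Suc n \<le> (onorm R * norm (R (Y x))) * s ^ n" for n
  proof -
    have "norm (T x) ^ Suc n \<le> norm ((T ^^ Suc n) x)"
      by (rule normal_operator_norm_power[OF bT _ x]) (use N in \<open>simp add: T_def\<close>)
    also have "\<dots> \<le> onorm R * norm ((S ^^ n) (R (Y x)))"
      unfolding Tpow by (rule bounded_clinear_norm_le[OF bR])
    also have "\<dots> \<le> onorm R * (s ^ n * norm (R (Y x)))"
      by (intro mult_left_mono pow bounded_clinear_onorm_nonneg[OF bR])
    finally show ?thesis by (simp add: mult_ac)
  qed
  from power_le_const_mult_power_imp_le[OF norm_ge_zero s0 this] have "norm (T x) \<le> s" .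
  also have "s \<le> spectral_radius T"
  proof (cases "s = 0")
    case True
    thus ?thesis using spectral_radius_nonneg[OF bT] by simp
  next
    case False
    have "\<exists>x::'a. x \<noteq> 0" using x by (metis norm_zero zero_neq_one)
    from onorm_poly_operator_attained[OF saS this, of "[:0, 1:]"]
    obtain t where t: "complex_of_real t \<in> spectrum S" "\<bar>t\<bar> = s"
      using bounded_clinear_zero[OF bS]
      by (auto simp: real_spectrum_def poly_operator_pCons[OF bS, abs_def] s_def)
    have "complex_of_real t \<in> spectrum T"
      unfolding T_def
      by (rule spectrum_commute[OF bR bounded_clinear_compose[OF bR bY]])
        (use t False in \<open>auto simp: S_def\<close>)
    from cmod_le_spectral_radius[OF bT this] show ?thesis using t(2) by simp
  qed
  finally show ?thesis by (simp add: T_def)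
qed

section \<open>The numerical radius bound\<close>

theorem proposition3p1:
  fixes A :: "'a::chilbert_space \<Rightarrow> 'a" and r \<theta> :: real
  assumes "bounded_clinear A"
    and "r \<ge> 1"
    and "0 \<le> \<theta>" and "\<theta> \<le> 1"
    and "normal_operator
          ((op_abs A powr\<^sub>o\<^sub>p (2 * r * \<theta>)) \<circ> (op_abs (cadjoint A) powr\<^sub>o\<^sub>p (2 * r * (1 - \<theta>))))"
  shows "numerical_radius A powr (2 * r) \<le>
      1/4 * onorm (\<lambda>x. (op_abs A powr\<^sub>o\<^sub>p (4 * r * \<theta>)) x
                     + (op_abs (cadjoint A) powr\<^sub>o\<^sub>p (4 * r * (1 - \<theta>))) x)
    + 1/2 * spectral_radius
        ((op_abs A powr\<^sub>o\<^sub>p (2 * r * \<theta>)) \<circ> (op_abs (cadjoint A) powr\<^sub>o\<^sub>p (2 * r * (1 - \<theta>))))"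
proof -
  note A = assms(1) and r = assms(2) and \<theta> = assms(3,4)
  define P Q where "P = op_abs A" and "Q = op_abs (cadjoint A)"
  have P: "positive_operator P" and Q: "positive_operator Q"
    unfolding P_def Q_def by (intro positive_op_abs A bounded_clinear_cadjoint)+
  define X Y where "X = P powr\<^sub>o\<^sub>p (2 * r * \<theta>)" and "Y = Q powr\<^sub>o\<^sub>p (2 * r * (1 - \<theta>))"
  have e0: "0 \<le> 2 * r * \<theta>" "0 \<le> 2 * r * (1 - \<theta>)" using r \<theta> by auto
  have posX: "positive_operator X" and posY: "positive_operator Y"
    unfolding X_def Y_def by (intro positive_op_powr P Q e0)+
  note saX = positive_operator_selfadjoint[OF posX] and saY = positive_operator_selfadjoint[OF posY]
  note bX = selfadjointD(1)[OF saX] and bY = selfadjointD(1)[OF saY]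
  define Z where "Z = (\<lambda>x. (P powr\<^sub>o\<^sub>p (4 * r * \<theta>)) x + (Q powr\<^sub>o\<^sub>p (4 * r * (1 - \<theta>))) x)"
  have Z: "Z x = X (X x) + Y (Y x)" for x
    using op_powr_op_powr_same[OF P e0(1), of x] op_powr_op_powr_same[OF Q e0(2), of x]
    by (simp add: Z_def X_def Y_def mult.assoc)
  have "Z = (\<lambda>x. X (X x) + Y (Y x))" by (rule ext) (rule Z)
  hence bZ: "bounded_clinear Z"
    using bounded_clinear_sum_ops(1)[OF bounded_clinear_compose[OF bX bX]
        bounded_clinear_compose[OF bY bY]] by simp
  define \<rho> where "\<rho> = spectral_radius (\<lambda>x. X (Y x))"
  define B where "B = 1/4 * onorm Z + 1/2 * \<rho>"
  have \<rho>0: "0 \<le> \<rho>" unfolding \<rho>_def by (rule spectral_radius_nonneg[OF bounded_clinear_compose[OF bX bY]])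
  have B0: "0 \<le> B" using \<rho>0 bounded_clinear_onorm_nonneg[OF bZ] by (simp add: B_def)
  have normal: "normal_operator (\<lambda>x. X (Y x))"
    using assms(5) by (simp add: X_def Y_def P_def Q_def o_def)
  have XY: "norm (X (Y x)) \<le> \<rho>" if "norm x = 1" for x
  proof -
    define R where "R = P powr\<^sub>o\<^sub>p (r * \<theta>)"
    have RR: "R (R v) = X v" for v
      using op_powr_op_powr_same[OF P, of "r * \<theta>" v] r \<theta> by (simp add: R_def X_def mult.assoc)
    have "selfadjoint R"
      unfolding R_def by (intro positive_operator_selfadjoint positive_op_powr P) (use r \<theta> in simp)
    from norm_normal_product_le_spectral_radius[OF this saY _ that]
    show ?thesis using normal by (simp add: RR \<rho>_def)
  qed
  have unit: "cmod (cinner (A x) x) powr (2 * r) \<le> B" if x: "norm x = 1" for x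
  proof -
    define a b where "a = Re (cinner ((P powr\<^sub>o\<^sub>p (2 * \<theta>)) x) x)"
      and "b = Re (cinner ((Q powr\<^sub>o\<^sub>p (2 * (1 - \<theta>))) x) x)"
    have ab0: "0 \<le> a" "0 \<le> b"
      using positive_op_powr[OF P, of "2 * \<theta>"] positive_op_powr[OF Q, of "2 * (1 - \<theta>)"] \<theta>
      by (auto simp: a_def b_def positive_operator_def)
    have "cmod (cinner (A x) x) powr (2 * r) = ((cmod (cinner (A x) x))\<^sup>2) powr r"
      by (simp add: powr_powr[symmetric] powr_numeral)
    also have "\<dots> \<le> (a * b) powr r"
      using mixed_Schwarz_inequality[OF A \<theta>, of x x] r
      by (intro powr_mono2) (auto simp: a_def b_def P_def Q_def)
    also have "\<dots> = a powr r * b powr r" using ab0 by (simp add: powr_mult)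
    also have "\<dots> \<le> Re (cinner (X x) x) * Re (cinner (Y x) x)"
    proof (rule mult_mono)
      show "a powr r \<le> Re (cinner (X x) x)"
        using Holder_McCarthy_inequality[OF P _ r x, of "2 * \<theta>"] \<theta>
        by (simp add: a_def X_def mult_ac)
      show "b powr r \<le> Re (cinner (Y x) x)"
        using Holder_McCarthy_inequality[OF Q _ r x, of "2 * (1 - \<theta>)"] \<theta>
        by (simp add: b_def Y_def mult_ac)
      show "0 \<le> Re (cinner (X x) x)" using posX by (simp add: positive_operator_def)
    qed simp
    also have "\<dots> \<le> cmod (cinner (X x) x * cinner x (Y x))"
    proof -
      have "Re (cinner (Y x) x) \<le> cmod (cinner x (Y x))"
        using complex_Re_le_cmod[of "cinner (Y x) x"] cmod_cinner_commute[of "Y x" x] by simp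
      thus ?thesis using complex_Re_le_cmod[of "cinner (X x) x"] posY
        by (simp add: norm_mult mult_mono positive_operator_def)
    qed
    also have "\<dots> \<le> 1/2 * (norm (X x) * norm (Y x)) + 1/2 * cmod (cinner (X x) (Y x))"
      using Buzano_inequality[OF x, of "X x" "Y x"] by simp
    also have "norm (X x) * norm (Y x) \<le> 1/2 * onorm Z"
    proof -
      have "2 * (norm (X x) * norm (Y x)) \<le> (norm (X x))\<^sup>2 + (norm (Y x))\<^sup>2"
        using sum_squares_bound[of "norm (X x)" "norm (Y x)"] by simp
      also have "\<dots> = Re (cinner (Z x) x)"
        by (simp add: Z cinner_simps power2_norm_eq_Re_cinner selfadjointD(2)[OF saX]
            selfadjointD(2)[OF saY])
      also have "\<dots> \<le> onorm Z"
        using complex_Re_le_cmod[of "cinner (Z x) x"] cmod_cinner_operator_le[OF bZ, of x x] x by simp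
      finally show ?thesis by simp
    qed
    also have "cmod (cinner (X x) (Y x)) \<le> \<rho>"
      using cinner_Cauchy_Schwarz[of x "X (Y x)"] XY[OF x] x by (simp add: selfadjointD(2)[OF saX])
    finally show ?thesis by (simp add: B_def)
  qed
  have "numerical_radius A \<le> B powr (1 / (2 * r))"
    unfolding numerical_radius_def
  proof (rule cSup_least)
    fix c assume "c \<in> insert 0 {cmod (cinner (A x) x) |x. norm x = 1}"
    then consider "c = 0" | x where "c = cmod (cinner (A x) x)" "norm x = 1" by blast
    thus "c \<le> B powr (1 / (2 * r))"
    proof cases
      case 2
      have "(c powr (2 * r)) powr (1 / (2 * r)) \<le> B powr (1 / (2 * r))"
        using unit[OF 2(2)] 2(1) r by (intro powr_mono2) auto
      thus ?thesis using r 2(1) by (simp add: powr_powr)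
    qed simp
  qed simp
  moreover have "0 \<le> numerical_radius A"
    unfolding numerical_radius_def
  proof (rule cSup_upper)
    show "bdd_above (insert 0 {cmod (cinner (A x) x) |x. norm x = 1})"
      using cmod_cinner_operator_le[OF A]
      by (intro bdd_aboveI[of _ "onorm A"])
        (use bounded_clinear_onorm_nonneg[OF A] in \<open>auto, metis mult.right_neutral\<close>)
  qed simp
  ultimately have "numerical_radius A powr (2 * r) \<le> (B powr (1 / (2 * r))) powr (2 * r)"
    using r by (intro powr_mono2) auto
  also have "\<dots> = B" using r B0 by (simp add: powr_powr)
  finally show ?thesis
    by (simp add: B_def \<rho>_def Z_def X_def Y_def P_def Q_def o_def)
qed

end
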